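(* For any $a\in\mathbb{C}$ there exist $T_a,\gamma>0$ (independent of $N,T,U$) such that for all integers $N\ge 2$ and all $U>0$, if $T\ge T_aN^{\gamma}$, then for any $\epsilon>0$, $$N_a(T,U)-N_{a,\epsilon}(T,U)=O_a\!\left(\frac{U\log N}{\epsilon}\right)+O_a\!\left(\frac{N^{2\gamma}\log(T+U)}{\epsilon}\right).$$ Here the constants implied by $O_a$ may depend on $a$ (and on the fixed data $F,\Omega,\lambda,\delta$) but not on $N,T,U,\epsilon$.
   Context: Write $s=\sigma+it$ with $\sigma,t\in\mathbb{R}$. Let $F(s)=\sum_{n=1}^\infty a_n\lambda_n^{-s}$ be a general Dirichlet series, absolutely convergent in some half-plane, with $a_n\in\mathbb{C}$, $\lambda_n$ real and strictly increasing, $\lambda_1=1$ (so $\lambda_n\ge1$), $a_2\neq0$, $a_3\ne0$ (possibly $a_1=0$), and $|a_n|$, $\lambda_n$ growing at most polynomially in $n$. Assume $F$ satisfies the functional equation $$\Omega(s)F(s)=\lambda^{2s-\delta}\Omega(\delta-s)F(\delta-s),\qquad \Omega(s)=\prod_{i=1}^k\Gamma(\alpha_is+\beta_i),$$ with $\lambda>0$, $\delta\in\mathbb{R}$, $\alpha_i>0$, $\beta_i\in\mathbb{R}$. Put $$F_N(s)=\sum_{n=1}^N\frac{a_n}{\lambda_n^s},\qquad G(s)=\lambda^{2s-\delta}\frac{\Omega(\delta-s)}{\Omega(s)},\qquad \zeta_N(s)=F_N(s)+G(s)F_N(\delta-s).$$ The critical line is $\sigma=\delta/2$. An $a$-value of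 $\zeta_N$ is a zero of $\zeta_N(s)-a$, counted with multiplicity. $N_a(T,U)$ is the number of $a$-values of $\zeta_N$ with $T<t<T+U$, and $N_{a,\epsilon}(T,U)$ is the number of those that also satisfy $|\sigma-\delta/2|<\epsilon$. It is always assumed that $T,U,\epsilon$ are such that no $a$-values lie on the boundaries of the regions involved (the lines $t=T$, $t=T+U$, $\sigma=\delta/2\pm\epsilon$). *)

theory Defs
  imports "HOL-Complex_Analysis.Complex_Analysis"
begin

text \<open>Sequences such as \<open>coef\<close> (the coefficients $a_n$) and \<open>freq\<close> (the $\lambda_n$) are indexed
  from 1; their values at 0 are never used.\<close>

definition dterm :: "(nat \<Rightarrow> complex) \<Rightarrow> (nat \<Rightarrow> real) \<Rightarrow> complex \<Rightarrow> nat \<Rightarrow> complex" where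
  "dterm coef freq s n = coef n / of_real (freq n) powr s"

text \<open>\<open>F\<close> is the meromorphic continuation to the whole plane of the general Dirichlet series:
  the series converges absolutely to \<open>F\<close> in some right half-plane.\<close>

definition continues_dirichlet_series ::
    "(nat \<Rightarrow> complex) \<Rightarrow> (nat \<Rightarrow> real) \<Rightarrow> (complex \<Rightarrow> complex) \<Rightarrow> bool" where
  "continues_dirichlet_series coef freq F \<longleftrightarrow>
     F meromorphic_on UNIV \<and>
     (\<exists>\<sigma>0::real. \<forall>s. Re s > \<sigma>0 \<longrightarrow>
        (\<lambda>n. norm (dterm coef freq s n)) summable_on {1..} \<and>
        (dterm coef freq s has_sum F s) {1..})"

definition polynomially_bounded :: "(nat \<Rightarrow> 'a::real_normed_vector) \<Rightarrow> bool" where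
  "polynomially_bounded x \<longleftrightarrow> (\<exists>K B::real. \<forall>n\<ge>1. norm (x n) \<le> K * real n powr B)"

definition Omega :: "nat \<Rightarrow> (nat \<Rightarrow> real) \<Rightarrow> (nat \<Rightarrow> real) \<Rightarrow> complex \<Rightarrow> complex" where
  "Omega k \<alpha> \<beta> s = (\<Prod>i=1..k. Gamma (of_real (\<alpha> i) * s + of_real (\<beta> i)))"

text \<open>The functional equation is an identity of meromorphic functions. It is required off a
  sparse set because library functions take arbitrary values at their poles
  (\<open>Gamma\<close> is 0 there).\<close>

definition functional_equation ::
    "nat \<Rightarrow> (nat \<Rightarrow> real) \<Rightarrow> (nat \<Rightarrow> real) \<Rightarrow> real \<Rightarrow> real \<Rightarrow> (complex \<Rightarrow> complex) \<Rightarrow> bool" where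
  "functional_equation k \<alpha> \<beta> lam \<delta> F \<longleftrightarrow>
     (\<forall>\<^sub>\<approx>s\<in>UNIV. Omega k \<alpha> \<beta> s * F s =
        of_real lam powr (2 * s - of_real \<delta>) * Omega k \<alpha> \<beta> (of_real \<delta> - s) * F (of_real \<delta> - s))"

definition F_trunc :: "(nat \<Rightarrow> complex) \<Rightarrow> (nat \<Rightarrow> real) \<Rightarrow> nat \<Rightarrow> complex \<Rightarrow> complex" where
  "F_trunc coef freq N s = (\<Sum>n=1..N. dterm coef freq s n)"

definition G_factor ::
    "nat \<Rightarrow> (nat \<Rightarrow> real) \<Rightarrow> (nat \<Rightarrow> real) \<Rightarrow> real \<Rightarrow> real \<Rightarrow> complex \<Rightarrow> complex" where
  "G_factor k \<alpha> \<beta> lam \<delta> s =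
     of_real lam powr (2 * s - of_real \<delta>) * Omega k \<alpha> \<beta> (of_real \<delta> - s) / Omega k \<alpha> \<beta> s"

definition zeta_trunc ::
    "(nat \<Rightarrow> complex) \<Rightarrow> (nat \<Rightarrow> real) \<Rightarrow> nat \<Rightarrow> (nat \<Rightarrow> real) \<Rightarrow> (nat \<Rightarrow> real) \<Rightarrow> real \<Rightarrow> real \<Rightarrow>
     nat \<Rightarrow> complex \<Rightarrow> complex" where
  "zeta_trunc coef freq k \<alpha> \<beta> lam \<delta> N s =
     F_trunc coef freq N s + G_factor k \<alpha> \<beta> lam \<delta> s * F_trunc coef freq N (of_real \<delta> - s)"

text \<open>The parameters $\alpha_i > 0$, $\beta_i$, $\delta$ are real, so every pole of a Gamma factor
  lies on the real axis, and \<open>zeta_trunc\<close> is holomorphic off it. The regions below are used only in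
  the upper half-plane, where a point with \<open>f s = a\<close> is therefore a genuine zero of \<open>f - a\<close> and
  \<open>zorder\<close> is its multiplicity.\<close>

definition a_values :: "(complex \<Rightarrow> complex) \<Rightarrow> complex \<Rightarrow> complex set" where
  "a_values f a = {s. f s - a = 0}"

text \<open>A sum over an infinite set is 0, so this is the number of a-values with multiplicity only
  when \<open>a_values f a \<inter> R\<close> is finite.\<close>

definition count_a_values :: "(complex \<Rightarrow> complex) \<Rightarrow> complex \<Rightarrow> complex set \<Rightarrow> int" where
  "count_a_values f a R = (\<Sum>s\<in>a_values f a \<inter> R. zorder (\<lambda>z. f z - a) s)"

definition strip :: "real \<Rightarrow> real \<Rightarrow> complex set" where
  "strip T U = {s. T < Im s \<and> Im s < T + U}"

definition near_line :: "real \<Rightarrow> real \<Rightarrow> complex set" where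
  "near_line \<delta> \<epsilon> = {s. \<bar>Re s - \<delta> / 2\<bar> < \<epsilon>}"

end

theory Submission
  imports Defs
begin

text \<open>
  On the half plane to the right of the critical line and high enough up, \<open>\<bar>G\<bar>\<close> decays so fast that
  \<open>f = \<zeta>\<^sub>N - a\<close> is bounded by a power of \<open>N\<close>, while to the right of some line \<open>Re s = \<delta>/2 + b\<close>, with
  \<open>b\<close> independent of \<open>N\<close>, the first nonvanishing term of the Dirichlet polynomial dominates and \<open>f\<close>
  has no zeros. Instead of Littlewood's lemma, a local estimate suffices: on a half disc of fixed
  radius resting on the critical line, replace each zero \<open>\<rho>\<close> of \<open>f\<close> by its mirror image in
  that line. The maximum modulus principle applied to the new function bounds the sum of the distances
  of the zeros in a box of unit height to the critical line by \<open>O(log N)\<close>. Summing over the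
  \<open>O(U + 1)\<close> boxes that cover the strip bounds the zeros at distance at least \<open>\<epsilon>\<close> on the right by
  \<open>O((U + 1) log N / \<epsilon>)\<close>. Since \<open>G(s) G(\<delta> - s) = 1\<close>, the point reflection \<open>s \<mapsto> \<delta> - s\<close> turns
  the zeros on the left into zeros on the right of \<open>F\<^sub>N(s) + G(s) (F\<^sub>N(\<delta> - s) - a)\<close>, a function of
  the same shape.
\<close>

section \<open>Ratios of Gamma values on horizontal lines\<close>

text \<open>Termwise comparison of Euler's product for \<open>\<Gamma>(w)/\<Gamma>(w + r)\<close> with the product at \<open>w = 1\<close>.\<close>

lemma norm_Gamma_shift_ge:
  fixes w :: complex and r :: real
  assumes "Re w \<ge> 1" "0 \<le> r"
  shows "norm (Gamma w) * Gamma (1 + r) \<le> norm (Gamma (w + of_real r))"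
proof -
  have step: "norm (Gamma_series w n) * Gamma_series (1 + r) n
      \<le> norm (Gamma_series (w + of_real r) n) * Gamma_series 1 n" (is "?L \<le> ?R") if n: "n > 0" for n
  proof -
    define A where "A z = (\<Prod>j=0..n. norm (z + of_nat j))" for z :: complex
    have nz: "norm (z + of_nat j) > 0" if "Re z \<ge> 1" for z :: complex and j :: nat
    proof -
      have "Re (z + of_nat j) > 0" using that by simp
      thus ?thesis by (metis complex_Re_le_cmod less_le_trans)
    qed
    have Apos: "A z > 0" if "Re z \<ge> 1" for z
      unfolding A_def using nz[OF that] by (intro prod_pos) auto
    have ns: "norm (Gamma_series z n) = fact n * exp (Re z * ln n) / A z" for z :: complex
      unfolding Gamma_series_def Suc_eq_plus1[symmetric] pochhammer_Suc_prod A_def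
      by (simp add: norm_divide norm_mult prod_norm)
    have rs: "Gamma_series x n = fact n * exp (x * ln n) / A (of_real x)" if "x \<ge> 1" for x :: real
    proof -
      have "norm (of_real x + of_nat j :: complex) = x + real j" for j
      proof -
        have "norm (of_real (x + real j) :: complex) = x + real j"
          using that by (subst norm_of_real) auto
        thus ?thesis by simp
      qed
      thus ?thesis unfolding Gamma_series_def Suc_eq_plus1[symmetric] pochhammer_Suc_prod A_def by simp
    qed
    \<comment> \<open>The inequality holds factor by factor. Passing from \<open>w\<close> to
      \<open>w + r\<close> raises the modulus by at most \<open>r\<close>, a relative increase of at
      most \<open>r / norm (w + j)\<close>; since \<open>Re w \<ge> 1\<close>, this is at most
      \<open>r / (1 + j)\<close>, the relative increase at \<open>1\<close>.\<close>
    have le: "A (w + of_real r) * A 1 \<le> A w * A (of_real (1 + r))"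
      unfolding A_def prod.distrib[symmetric]
    proof (rule prod_mono, safe)
      fix j :: nat
      have a: "norm (w + of_real r + of_nat j) \<le> norm (w + of_nat j) + r"
        using norm_triangle_ineq[of "w + of_nat j" "of_real r"] assms by (simp add: algebra_simps)
      have b: "1 + real j \<le> norm (w + of_nat j)"
        using complex_Re_le_cmod[of "w + of_nat j"] assms by simp
      have c: "norm (1 + of_nat j :: complex) = 1 + real j"
        using norm_of_nat[of "Suc j", where 'a = complex] by simp
      have d: "norm (of_real (1 + r) + of_nat j :: complex) = 1 + r + real j"
        using norm_of_real[of "1 + r + real j", where 'a = complex] assms by simp
      have "norm (w + of_real r + of_nat j) * (1 + real j) \<le> (norm (w + of_nat j) + r) * (1 + real j)"
        using a by (intro mult_right_mono) auto
      also have "\<dots> \<le> norm (w + of_nat j) * (1 + real j) + r * norm (w + of_nat j)"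
        using mult_left_mono[OF b, of r] assms by (simp add: algebra_simps)
      also have "\<dots> = norm (w + of_nat j) * (1 + r + real j)" by (simp add: algebra_simps)
      finally show "norm (w + of_real r + of_nat j) * norm (1 + of_nat j :: complex)
          \<le> norm (w + of_nat j) * norm (of_real (1 + r) + of_nat j :: complex)"
        unfolding c d .
    qed auto
    \<comment> \<open>The powers of \<open>n\<close> in the two products of series have equal
      modulus, so only the products \<open>A\<close> matter.\<close>
    have e: "exp (Re w * ln n) * exp ((1 + r) * ln n) = exp (Re (w + of_real r) * ln n) * exp (1 * ln n)"
      unfolding exp_add[symmetric] by (simp add: algebra_simps)
    have "?L = fact n * fact n * (exp (Re w * ln n) * exp ((1 + r) * ln n)) / (A w * A (of_real (1 + r)))"
      using assms by (simp add: ns rs)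
    also have "\<dots> \<le> fact n * fact n * (exp (Re w * ln n) * exp ((1 + r) * ln n)) / (A (w + of_real r) * A 1)"
      using assms le by (intro divide_left_mono mult_pos_pos Apos) auto
    also have "\<dots> = ?R" unfolding e using assms by (simp add: ns rs)
    finally show ?thesis .
  qed
  have "norm (Gamma w) * Gamma (1 + r) \<le> norm (Gamma (w + of_real r)) * Gamma 1"
  proof (rule tendsto_le[OF sequentially_bot])
    show "(\<lambda>n. norm (Gamma_series (w + of_real r) n) * Gamma_series 1 n)
        \<longlonglongrightarrow> norm (Gamma (w + of_real r)) * Gamma 1" by (intro tendsto_intros)
    show "(\<lambda>n. norm (Gamma_series w n) * Gamma_series (1 + r) n)
        \<longlonglongrightarrow> norm (Gamma w) * Gamma (1 + r)" by (intro tendsto_intros)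
    show "\<forall>\<^sub>F n in sequentially. norm (Gamma_series w n) * Gamma_series (1 + r) n
        \<le> norm (Gamma_series (w + of_real r) n) * Gamma_series 1 n"
      using eventually_gt_at_top[of 0] by eventually_elim (rule step)
  qed
  thus ?thesis by simp
qed

lemma not_nonpos_Ints_of_Im: "Im w \<noteq> 0 \<Longrightarrow> w \<notin> \<int>\<^sub>\<le>\<^sub>0"
  by (auto elim!: nonpos_Ints_cases)

lemma Gamma_plus1_Im: "Im w \<noteq> 0 \<Longrightarrow> Gamma (w + 1) = w * Gamma w"
  by (simp add: Gamma_plus1 not_nonpos_Ints_of_Im)

text \<open>For \<open>Re w \<ge> 1\<close> the constant comes from the minimum of
  \<open>Gamma\<close> on [1, 2]. Each unit step to the left by the functional equation multiplies
  it by \<open>norm (w + r) / norm w\<close>. Only the at most two steps with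
  \<open>Re w \<ge> -1\<close> cost anything, a factor of at most 2 each, so the constant is uniform
  in \<open>Re w\<close>.\<close>

lemma norm_Gamma_fractional_shift:
  obtains C :: real where "C \<ge> 1"
    "\<And>w r. Im w \<ge> 1 \<Longrightarrow> 0 \<le> r \<Longrightarrow> r \<le> 1 \<Longrightarrow> norm (Gamma w) \<le> C * norm (Gamma (w + of_real r))"
proof -
  have "continuous_on {1..2::real} Gamma"
    by (intro continuous_on_Gamma continuous_on_id) (auto elim!: nonpos_Ints_cases)
  then obtain x0 where x0: "x0 \<in> {1..2}" "\<And>x. x \<in> {1..2::real} \<Longrightarrow> Gamma x0 \<le> Gamma x"
    using continuous_attains_inf[of "{1..2::real}" Gamma] by auto
  define g where "g = Gamma x0"
  have g: "g > 0" unfolding g_def using x0 by (intro Gamma_real_pos) auto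
  define K where "K = max 1 (1 / g)"
  have K1: "K \<ge> 1" by (simp add: K_def)
  \<comment> \<open>The induction is on a bound \<open>m\<close> for the number of unit steps that
    lead to \<open>Re w \<ge> 1\<close>; the values 1, 2, 4 record the accumulated loss.\<close>
  have main: "norm (Gamma w) \<le> K * (if Re w \<ge> 1 then 1 else if Re w \<ge> 0 then 2 else 4) * norm (Gamma (w + of_real r))"
    if "Re w + real m \<ge> 1" "Im w \<ge> 1" and r: "0 \<le> r" "r \<le> 1" for w r m
    using that(1,2)
  proof (induction m arbitrary: w)
    case 0
    hence "norm (Gamma w) * g \<le> norm (Gamma w) * Gamma (1 + r)"
      unfolding g_def using r by (intro mult_left_mono x0) auto
    also have "\<dots> \<le> norm (Gamma (w + of_real r))"
      using 0 r by (intro norm_Gamma_shift_ge) auto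
    finally have "norm (Gamma w) \<le> (1 / g) * norm (Gamma (w + of_real r))"
      using g by (simp add: field_simps)
    also have "\<dots> \<le> K * norm (Gamma (w + of_real r))"
      by (intro mult_right_mono) (auto simp: K_def)
    finally show ?case using 0 by simp
  next
    case (Suc m)
    show ?case
    proof (cases "Re w \<ge> 1")
      case True
      thus ?thesis using Suc.IH[of w] Suc.prems by (cases m) (auto intro: Suc.IH)
    next
      case False
      let ?c = "\<lambda>w. (if Re w \<ge> 1 then 1 else if Re w \<ge> 0 then 2 else 4 :: real)"
      have w: "norm w \<ge> 1" using Suc.prems abs_Im_le_cmod[of w] by simp
      have g1: "norm w * norm (Gamma w) = norm (Gamma (w + 1))"
        using Suc.prems by (subst Gamma_plus1_Im) (auto simp: norm_mult)
      have g2: "norm (w + of_real r) * norm (Gamma (w + of_real r)) = norm (Gamma (w + 1 + of_real r))"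
        using Suc.prems Gamma_plus1_Im[of "w + of_real r"] by (auto simp: norm_mult add_ac)
      have IH: "norm (Gamma (w + 1)) \<le> K * ?c (w + 1) * norm (Gamma (w + 1 + of_real r))"
        using Suc.prems by (intro Suc.IH) auto
      have q: "?c (w + 1) * norm (w + of_real r) \<le> ?c w * norm w"
      proof (cases "Re w \<ge> -1")
        case True
        have "norm (w + of_real r) \<le> norm w + r" using norm_triangle_ineq[of w "of_real r"] r by simp
        hence "norm (w + of_real r) \<le> 2 * norm w" using w r by simp
        thus ?thesis using True False by (auto intro: order_trans)
      next
        \<comment> \<open>Left of \<open>Re w = -1\<close> a shift by \<open>r \<le> 1\<close> does
          not increase \<open>\<bar>Re w\<bar>\<close>, so the step is free.\<close>
        case Fa: False
        have "(Re w + r)\<^sup>2 \<le> (Re w)\<^sup>2" using Fa r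
          by (subst abs_le_square_iff[symmetric]) auto
        hence "norm (w + of_real r) \<le> norm w" unfolding cmod_def by simp
        thus ?thesis using Fa by simp
      qed
      have "norm w * norm (Gamma w) \<le> K * ?c (w + 1) * (norm (w + of_real r) * norm (Gamma (w + of_real r)))"
        using IH unfolding g1 g2 .
      also have "\<dots> = K * (?c (w + 1) * norm (w + of_real r)) * norm (Gamma (w + of_real r))" by simp
      also have "\<dots> \<le> K * (?c w * norm w) * norm (Gamma (w + of_real r))"
        using q K1 by (intro mult_right_mono mult_left_mono) auto
      finally have "norm w * norm (Gamma w) \<le> norm w * (K * ?c w * norm (Gamma (w + of_real r)))"
        by (simp add: mult_ac)
      thus ?thesis using w by (subst (asm) mult_le_cancel_left_pos) auto
    qed
  qed
  show ?thesis
  proof (rule that[of "4 * K"])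
    show "4 * K \<ge> 1" using K1 by simp
    fix w :: complex and r :: real assume w: "Im w \<ge> 1" "0 \<le> r" "r \<le> 1"
    obtain m :: nat where m: "1 - Re w \<le> real m" using real_arch_simple by blast
    have "norm (Gamma w) \<le> K * (if Re w \<ge> 1 then 1 else if Re w \<ge> 0 then 2 else 4) * norm (Gamma (w + of_real r))"
      using m w by (intro main[of _ m]) auto
    also have "\<dots> \<le> (4 * K) * norm (Gamma (w + of_real r))"
      using K1 by (intro mult_right_mono) auto
    finally show "norm (Gamma w) \<le> 4 * K * norm (Gamma (w + of_real r))" .
  qed
qed

lemma norm_Gamma_nat_shift:
  assumes "Im w > 0"
  shows "Im w ^ m * norm (Gamma w) \<le> norm (Gamma (w + of_nat m))"
proof (induction m)
  case (Suc m)
  have eq: "Gamma (w + of_nat (Suc m)) = (w + of_nat m) * Gamma (w + of_nat m)"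
    using assms Gamma_plus1_Im[of "w + of_nat m"] by (simp add: algebra_simps)
  have "Im w \<le> norm (w + of_nat m)" using abs_Im_le_cmod[of "w + of_nat m"] assms by simp
  hence "Im w * (Im w ^ m * norm (Gamma w)) \<le> norm (w + of_nat m) * norm (Gamma (w + of_nat m))"
    using Suc assms by (intro mult_mono) auto
  thus ?case unfolding eq by (simp add: norm_mult mult_ac)
qed auto

text \<open>In Euler's product the factors at conjugate points have equal modulus. This serves to
  bring the arguments belonging to \<open>\<delta> - s\<close> and \<open>s\<close> to the same
  height.\<close>

lemma norm_Gamma_cnj: "norm (Gamma (cnj w)) = norm (Gamma (w :: complex))"
proof (rule LIMSEQ_unique)
  show "(\<lambda>n. norm (Gamma_series w n)) \<longlonglongrightarrow> norm (Gamma w)" by (intro tendsto_intros)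
  have "norm (cnj w + of_nat j) = norm (w + of_nat j)" for j
    using complex_mod_cnj[of "w + of_nat j"] by simp
  hence "norm (Gamma_series (cnj w) n) = norm (Gamma_series w n)" for n
    unfolding Gamma_series_def Suc_eq_plus1[symmetric] pochhammer_Suc_prod
    by (simp add: norm_divide norm_mult flip: prod_norm)
  moreover have "(\<lambda>n. norm (Gamma_series (cnj w) n)) \<longlonglongrightarrow> norm (Gamma (cnj w))" by (intro tendsto_intros)
  ultimately show "(\<lambda>n. norm (Gamma_series w n)) \<longlonglongrightarrow> norm (Gamma (cnj w))" by simp
qed

text \<open>The integer part of \<open>u\<close> yields the power of
  \<open>\<bar>Im w\<bar>\<close>, the fractional part costs only a constant, and conjugation covers
  negative \<open>Im w\<close>.\<close>

lemma norm_Gamma_ratio: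
  obtains C :: real where "C \<ge> 1"
    "\<And>w u. \<bar>Im w\<bar> \<ge> 1 \<Longrightarrow> 0 \<le> u \<Longrightarrow>
       norm (Gamma w) * \<bar>Im w\<bar> ^ nat \<lfloor>u\<rfloor> \<le> C * norm (Gamma (w + of_real u))"
proof -
  obtain C where C: "C \<ge> 1"
    "\<And>w r. Im w \<ge> 1 \<Longrightarrow> 0 \<le> r \<Longrightarrow> r \<le> 1 \<Longrightarrow> norm (Gamma w) \<le> C * norm (Gamma (w + of_real r))"
    using norm_Gamma_fractional_shift by blast
  have pos: "norm (Gamma w) * Im w ^ nat \<lfloor>u\<rfloor> \<le> C * norm (Gamma (w + of_real u))"
    if "Im w \<ge> 1" "0 \<le> u" for w u
  proof -
    define m where "m = nat \<lfloor>u\<rfloor>"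
    have r: "0 \<le> u - real m" "u - real m \<le> 1" using that unfolding m_def by linarith+
    have "norm (Gamma w) * Im w ^ m \<le> (C * norm (Gamma (w + of_real (u - real m)))) * Im w ^ m"
      using that C(2)[OF that(1) r] by (intro mult_right_mono) auto
    also have "\<dots> \<le> C * norm (Gamma (w + of_real (u - real m) + of_nat m))"
      using norm_Gamma_nat_shift[of "w + of_real (u - real m)" m] that C(1)
      by (simp add: mult_ac)
    finally show ?thesis by (simp add: m_def)
  qed
  show ?thesis
  proof (rule that[OF C(1)])
    fix w :: complex and u :: real assume w: "\<bar>Im w\<bar> \<ge> 1" "0 \<le> u"
    show "norm (Gamma w) * \<bar>Im w\<bar> ^ nat \<lfloor>u\<rfloor> \<le> C * norm (Gamma (w + of_real u))"
    proof (cases "Im w \<ge> 0")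
      case True thus ?thesis using pos[of w u] w by simp
    next
      case False
      have "norm (Gamma (w + of_real u)) = norm (Gamma (cnj w + of_real u))"
        using norm_Gamma_cnj[of "w + of_real u"] by simp
      thus ?thesis using pos[of "cnj w" u] w False norm_Gamma_cnj[of w] by simp
    qed
  qed
qed

section \<open>Size of \<open>G\<close> to the right of the critical line\<close>

lemma norm_of_real_powr: "x > 0 \<Longrightarrow> norm (of_real x powr (s :: complex)) = x powr Re s"
  by (subst norm_powr_real_powr) auto

text \<open>Up to conjugation, the two arguments of the i-th Gamma quotient in \<open>G\<close>
  differ by the real shift \<open>2 * \<alpha> i * (Re s - \<delta> / 2)\<close>, so
  \<open>norm_Gamma_ratio\<close> applies. Decay in \<open>\<bar>Im s\<bar>\<close> is taken from
  the first quotient; the others are merely bounded by \<open>C\<close>.\<close>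

lemma G_factor_bound:
  assumes k: "k \<ge> 1" and \<alpha>: "\<And>i. i \<in> {1..k} \<Longrightarrow> \<alpha> i > 0" and lam: "lam > 0"
  obtains C L e y \<tau>\<^sub>0 :: real where "C \<ge> 1" "L \<ge> 1" "e > 0" "y \<ge> 1" "\<tau>\<^sub>0 > 0"
    "\<And>s. \<bar>Im s\<bar> \<ge> y \<Longrightarrow> Re s \<ge> \<delta> / 2 \<Longrightarrow>
       norm (G_factor k \<alpha> \<beta> lam \<delta> s) \<le> C * L powr (Re s - \<delta> / 2)"
    "\<And>s. \<bar>Im s\<bar> \<ge> y \<Longrightarrow> Re s \<ge> \<delta> / 2 + \<tau>\<^sub>0 \<Longrightarrow>
       norm (G_factor k \<alpha> \<beta> lam \<delta> s) \<le> C * (L * \<bar>Im s\<bar> powr (- e)) powr (Re s - \<delta> / 2)"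
proof -
  obtain C where C: "C \<ge> 1"
    "\<And>w u. \<bar>Im w\<bar> \<ge> 1 \<Longrightarrow> 0 \<le> u \<Longrightarrow>
       norm (Gamma w) * \<bar>Im w\<bar> ^ nat \<lfloor>u\<rfloor> \<le> C * norm (Gamma (w + of_real u))"
    using norm_Gamma_ratio by blast
  have a1: "\<alpha> 1 > 0" using \<alpha>[of 1] k by simp
  \<comment> \<open>The sum ensures \<open>\<alpha> i * \<bar>t\<bar> \<ge> 1\<close> for all
    \<open>i\<close> at once, as the ratio bound requires.\<close>
  define y where "y = 1 + (\<Sum>i=1..k. 1 / \<alpha> i)"
  have y1: "y \<ge> 1" unfolding y_def using \<alpha> by (auto intro!: sum_nonneg simp: less_imp_le)
  have ay: "\<alpha> i * \<bar>t\<bar> \<ge> 1" if "i \<in> {1..k}" "\<bar>t\<bar> \<ge> y" for i t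
  proof -
    have "1 / \<alpha> i \<le> (\<Sum>i=1..k. 1 / \<alpha> i)"
      using that(1) \<alpha> by (intro member_le_sum) (auto simp: less_imp_le)
    hence "1 / \<alpha> i \<le> \<bar>t\<bar>" using that(2) unfolding y_def by linarith
    thus ?thesis using \<alpha>[OF that(1)] by (simp add: field_simps)
  qed
  \<comment> \<open>\<open>L\<close> absorbs \<open>lam ^ 2\<close>, from the power of
    \<open>lam\<close> in \<open>G\<close>, and \<open>\<alpha> 1 powr (- \<alpha> 1)\<close>, from
    the base \<open>\<alpha> 1 * \<bar>Im s\<bar>\<close> of the decay.\<close>
  define L where "L = max 1 (lam ^ 2) * max 1 (\<alpha> 1 powr (- \<alpha> 1))"
  have L1: "L \<ge> 1" unfolding L_def using mult_mono[of 1 "max 1 (lam ^ 2)" 1 "max 1 (\<alpha> 1 powr (- \<alpha> 1))"] by simp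
  have main: "norm (G_factor k \<alpha> \<beta> lam \<delta> s) \<le>
      C ^ k * (lam ^ 2) powr (Re s - \<delta> / 2) / (\<alpha> 1 * \<bar>Im s\<bar>) ^ nat \<lfloor>2 * \<alpha> 1 * (Re s - \<delta> / 2)\<rfloor>"
    if t: "\<bar>Im s\<bar> \<ge> y" and \<sigma>: "Re s \<ge> \<delta> / 2" for s
  proof -
    define u where "u i = 2 * \<alpha> i * (Re s - \<delta> / 2)" for i
    define r where "r i = norm (Gamma (of_real (\<alpha> i) * (of_real \<delta> - s) + of_real (\<beta> i))) /
       norm (Gamma (of_real (\<alpha> i) * s + of_real (\<beta> i)))" for i
    have r: "r i \<le> C / (\<alpha> i * \<bar>Im s\<bar>) ^ nat \<lfloor>u i\<rfloor>" if i: "i \<in> {1..k}" for i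
    proof -
      define w where "w = cnj (of_real (\<alpha> i) * (of_real \<delta> - s) + of_real (\<beta> i))"
      have Iw: "\<bar>Im w\<bar> = \<alpha> i * \<bar>Im s\<bar>" using \<alpha>[OF i] by (simp add: w_def abs_mult)
      have wu: "w + of_real (u i) = of_real (\<alpha> i) * s + of_real (\<beta> i)"
        unfolding w_def u_def by (simp add: complex_eq_iff algebra_simps)
      have "norm (Gamma w) * \<bar>Im w\<bar> ^ nat \<lfloor>u i\<rfloor> \<le> C * norm (Gamma (w + of_real (u i)))"
        using ay[OF i t] \<alpha>[OF i] \<sigma> by (intro C) (auto simp: Iw u_def)
      hence *: "norm (Gamma w) * (\<alpha> i * \<bar>Im s\<bar>) ^ nat \<lfloor>u i\<rfloor> \<le> C * norm (Gamma (of_real (\<alpha> i) * s + of_real (\<beta> i)))"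
        unfolding Iw wu .
      have p: "(\<alpha> i * \<bar>Im s\<bar>) ^ nat \<lfloor>u i\<rfloor> > 0" using ay[OF i t] by (intro zero_less_power) linarith
      have "Im (of_real (\<alpha> i) * s + of_real (\<beta> i)) \<noteq> 0" using ay[OF i t] by auto
      hence "norm (Gamma (of_real (\<alpha> i) * s + of_real (\<beta> i))) > 0"
        by (simp add: Gamma_eq_zero_iff not_nonpos_Ints_of_Im)
      moreover have "r i = norm (Gamma w) / norm (Gamma (of_real (\<alpha> i) * s + of_real (\<beta> i)))"
        unfolding r_def w_def norm_Gamma_cnj ..
      ultimately show ?thesis using * p by (simp add: divide_le_eq le_divide_eq)
    qed
    have r': "r i \<le> C" if i: "i \<in> {1..k}" for i
    proof -
      have "C / (\<alpha> i * \<bar>Im s\<bar>) ^ nat \<lfloor>u i\<rfloor> \<le> C / 1"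
        using ay[OF i t] C(1) by (intro divide_left_mono one_le_power) auto
      thus ?thesis using r[OF i] by simp
    qed
    have eq: "norm (G_factor k \<alpha> \<beta> lam \<delta> s) = lam powr (2 * Re s - \<delta>) * (\<Prod>i=1..k. r i)"
      unfolding G_factor_def Omega_def r_def using lam
      by (simp add: norm_mult norm_divide norm_of_real_powr prod_dividef flip: prod_norm)
    have "(\<Prod>i=1..k. r i) = r 1 * (\<Prod>i=2..k. r i)"
      using k by (simp add: prod.atLeast_Suc_atMost numeral_2_eq_2)
    also have "\<dots> \<le> (C / (\<alpha> 1 * \<bar>Im s\<bar>) ^ nat \<lfloor>u 1\<rfloor>) * (\<Prod>i=2..k. C)"
    proof (rule mult_mono)
      show "(\<Prod>i=2..k. r i) \<le> (\<Prod>i=2..k. C)" using r' by (intro prod_mono) (auto simp: r_def)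
      show "0 \<le> C / (\<alpha> 1 * \<bar>Im s\<bar>) ^ nat \<lfloor>u 1\<rfloor>"
        using C(1) a1 by (intro divide_nonneg_nonneg zero_le_power) auto
    qed (use r[of 1] k in \<open>auto intro!: prod_nonneg simp: r_def\<close>)
    also have "\<dots> = C ^ k / (\<alpha> 1 * \<bar>Im s\<bar>) ^ nat \<lfloor>u 1\<rfloor>"
      using k by (cases k) auto
    finally have le: "(\<Prod>i=1..k. r i) \<le> C ^ k / (\<alpha> 1 * \<bar>Im s\<bar>) ^ nat \<lfloor>u 1\<rfloor>" .
    have "lam ^ 2 = lam powr 2" using lam by simp
    hence "(lam ^ 2) powr (Re s - \<delta> / 2) = lam powr (2 * Re s - \<delta>)"
      by (simp only: powr_powr) (simp add: algebra_simps)
    thus ?thesis using mult_left_mono[OF le, of "lam powr (2 * Re s - \<delta>)"]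
      by (simp add: eq u_def mult_ac)
  qed
  have Lp: "(lam ^ 2) powr \<tau> \<le> L powr \<tau>" if "\<tau> \<ge> 0" for \<tau>
  proof (rule powr_mono2)
    show "lam ^ 2 \<le> L" unfolding L_def using mult_mono[of "lam ^ 2" "max 1 (lam ^ 2)" 1 "max 1 (\<alpha> 1 powr (- \<alpha> 1))"] by simp
  qed (use that in auto)
  show ?thesis
  \<comment> \<open>Here \<open>e = \<alpha> 1\<close> and
    \<open>\<tau>\<^sub>0 = 1 / (2 * \<alpha> 1)\<close>. From this distance on the exponent
    \<open>2 * \<alpha> 1 * \<tau>\<close> is at least 1, so rounding it down loses at most half of
    it and leaves \<open>\<alpha> 1 * \<tau>\<close>.\<close>
  proof (rule that[of "C ^ k" L "\<alpha> 1" y "1 / (2 * \<alpha> 1)"])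
    show "C ^ k \<ge> 1" using C(1) by simp
    show "L \<ge> 1" "y \<ge> 1" "\<alpha> 1 > 0" "1 / (2 * \<alpha> 1) > 0" using L1 y1 a1 by auto
    fix s assume t: "\<bar>Im s\<bar> \<ge> y"
    have at: "\<alpha> 1 * \<bar>Im s\<bar> \<ge> 1" using ay[of 1 "Im s"] t k by simp
    show "norm (G_factor k \<alpha> \<beta> lam \<delta> s) \<le> C ^ k * L powr (Re s - \<delta> / 2)" if "Re s \<ge> \<delta> / 2"
    proof -
      note main[OF t that]
      also have "C ^ k * (lam ^ 2) powr (Re s - \<delta> / 2) / (\<alpha> 1 * \<bar>Im s\<bar>) ^ nat \<lfloor>2 * \<alpha> 1 * (Re s - \<delta> / 2)\<rfloor>
          \<le> C ^ k * (lam ^ 2) powr (Re s - \<delta> / 2) / 1"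
        using at C(1) by (intro divide_left_mono one_le_power) auto
      also have "\<dots> \<le> C ^ k * L powr (Re s - \<delta> / 2)"
        using C(1) that by (auto intro!: mult_left_mono Lp)
      finally show ?thesis .
    qed
    show "norm (G_factor k \<alpha> \<beta> lam \<delta> s) \<le> C ^ k * (L * \<bar>Im s\<bar> powr (- \<alpha> 1)) powr (Re s - \<delta> / 2)"
      if \<sigma>: "Re s \<ge> \<delta> / 2 + 1 / (2 * \<alpha> 1)"
    proof -
      define \<tau> where "\<tau> = Re s - \<delta> / 2"
      have a0: "0 < 1 / (2 * \<alpha> 1)" using a1 by simp
      have \<tau>: "2 * \<alpha> 1 * \<tau> \<ge> 1" using \<sigma> a1 by (simp add: \<tau>_def field_simps)
      have \<tau>0: "\<tau> \<ge> 0" using \<sigma> a0 unfolding \<tau>_def by linarith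
      have "real (nat \<lfloor>v\<rfloor>) \<ge> v / 2" if "v \<ge> 1" for v :: real
      proof -
        have "\<lfloor>v\<rfloor> \<ge> 1" using that by (simp add: le_floor_iff)
        thus ?thesis by linarith
      qed
      from this[OF \<tau>] have fl: "real (nat \<lfloor>2 * \<alpha> 1 * \<tau>\<rfloor>) \<ge> \<alpha> 1 * \<tau>" by simp
      have "(\<alpha> 1 * \<bar>Im s\<bar>) powr (\<alpha> 1 * \<tau>) \<le> (\<alpha> 1 * \<bar>Im s\<bar>) powr real (nat \<lfloor>2 * \<alpha> 1 * \<tau>\<rfloor>)"
        using at fl by (intro powr_mono) auto
      also have "\<dots> = (\<alpha> 1 * \<bar>Im s\<bar>) ^ nat \<lfloor>2 * \<alpha> 1 * \<tau>\<rfloor>" using at by (intro powr_realpow) auto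
      finally have le: "(\<alpha> 1 * \<bar>Im s\<bar>) powr (\<alpha> 1 * \<tau>) \<le> (\<alpha> 1 * \<bar>Im s\<bar>) ^ nat \<lfloor>2 * \<alpha> 1 * \<tau>\<rfloor>" .
      have pp: "(\<alpha> 1 * \<bar>Im s\<bar>) powr (\<alpha> 1 * \<tau>) > 0" using at by auto
      have "norm (G_factor k \<alpha> \<beta> lam \<delta> s) \<le>
          C ^ k * (lam ^ 2) powr \<tau> / (\<alpha> 1 * \<bar>Im s\<bar>) ^ nat \<lfloor>2 * \<alpha> 1 * \<tau>\<rfloor>"
        unfolding \<tau>_def using \<tau>0 by (intro main t) (auto simp: \<tau>_def)
      also have "\<dots> \<le> C ^ k * (lam ^ 2) powr \<tau> / (\<alpha> 1 * \<bar>Im s\<bar>) powr (\<alpha> 1 * \<tau>)"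
        using le pp order_less_le_trans[OF pp le] C(1) by (intro divide_left_mono mult_pos_pos) auto
      also have "\<dots> = C ^ k * (lam ^ 2 / (\<alpha> 1 * \<bar>Im s\<bar>) powr \<alpha> 1) powr \<tau>"
        by (simp add: powr_divide powr_powr)
      also have "lam ^ 2 / (\<alpha> 1 * \<bar>Im s\<bar>) powr \<alpha> 1 = lam ^ 2 * \<alpha> 1 powr (- \<alpha> 1) * \<bar>Im s\<bar> powr (- \<alpha> 1)"
        using a1 by (simp add: powr_mult powr_minus_divide)
      also have "C ^ k * (lam ^ 2 * \<alpha> 1 powr (- \<alpha> 1) * \<bar>Im s\<bar> powr (- \<alpha> 1)) powr \<tau> \<le>
          C ^ k * (L * \<bar>Im s\<bar> powr (- \<alpha> 1)) powr \<tau>"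
      proof (intro mult_left_mono powr_mono2 \<tau>0)
        show "lam ^ 2 * \<alpha> 1 powr (- \<alpha> 1) * \<bar>Im s\<bar> powr (- \<alpha> 1) \<le> L * \<bar>Im s\<bar> powr (- \<alpha> 1)"
          unfolding L_def by (intro mult_right_mono mult_mono) auto
      qed (use C(1) in auto)
      finally show ?thesis by (simp add: \<tau>_def)
    qed
  qed
qed

section \<open>Zeros in half discs and strips\<close>

text \<open>The order of vanishing is only bounded from below, as \<open>h\<close> may vanish at
  \<open>\<rho>\<close>. This is enough for upper bounds on weighted sums over zeros and is easily
  carried through products and reflections.\<close>

definition vanishes_to :: "(complex \<Rightarrow> complex) \<Rightarrow> complex \<Rightarrow> nat \<Rightarrow> bool" where
  "vanishes_to f \<rho> n \<longleftrightarrow>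
     (\<exists>h r. r > 0 \<and> h holomorphic_on ball \<rho> r \<and> (\<forall>z\<in>ball \<rho> r. f z = (z - \<rho>) ^ n * h z))"

lemma vanishes_to_cancel:
  assumes "vanishes_to f \<rho> n" "open S" "\<rho> \<in> S" "P holomorphic_on S" "P \<rho> \<noteq> 0"
    and eq: "\<And>z. z \<in> S \<Longrightarrow> f z = P z * g z"
  shows "vanishes_to g \<rho> n"
proof -
  obtain h r where h: "r > 0" "h holomorphic_on ball \<rho> r" "\<And>z. z \<in> ball \<rho> r \<Longrightarrow> f z = (z - \<rho>) ^ n * h z"
    using assms(1) unfolding vanishes_to_def by blast
  have "continuous_on S P" using assms(4) by (rule holomorphic_on_imp_continuous_on)
  hence "open (S \<inter> P -` (- {0}))"
    using assms(2) by (rule continuous_open_preimage) auto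
  hence "open {z \<in> S. P z \<noteq> 0}" by (simp add: vimage_def Int_def)
  moreover have "\<rho> \<in> {z \<in> S. P z \<noteq> 0}" using assms by simp
  ultimately obtain e where e: "e > 0" "ball \<rho> e \<subseteq> {z \<in> S. P z \<noteq> 0}"
    by (meson open_contains_ball_eq)
  show ?thesis unfolding vanishes_to_def
  proof (intro exI conjI ballI)
    show "min e r > 0" using e h by simp
    show "(\<lambda>z. h z / P z) holomorphic_on ball \<rho> (min e r)"
      using h(2) assms(4) e(2)
      by (intro holomorphic_on_divide) (auto elim!: holomorphic_on_subset)
    fix z assume z: "z \<in> ball \<rho> (min e r)"
    hence "P z \<noteq> 0" "z \<in> S" using e(2) by auto
    thus "g z = (z - \<rho>) ^ n * (h z / P z)" using eq[of z] h(3)[of z] z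
      by (simp add: field_simps)
  qed
qed

text \<open>The local cofactor \<open>h\<close> near \<open>\<rho>\<close> and
  \<open>f z / (z - \<rho>) ^ n\<close> away from it agree on the punctured ball, so they glue to a
  holomorphic function on all of \<open>S\<close>.\<close>

lemma vanishes_to_divide:
  assumes "open S" "f holomorphic_on S" "\<rho> \<in> S" "vanishes_to f \<rho> n"
  obtains g where "g holomorphic_on S" "\<And>z. z \<in> S \<Longrightarrow> f z = (z - \<rho>) ^ n * g z"
proof -
  obtain h r0 where h0: "r0 > 0" "h holomorphic_on ball \<rho> r0" "\<And>z. z \<in> ball \<rho> r0 \<Longrightarrow> f z = (z - \<rho>) ^ n * h z"
    using assms(4) unfolding vanishes_to_def by blast
  obtain e where e: "e > 0" "ball \<rho> e \<subseteq> S" using assms by (meson open_contains_ball_eq)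
  define r where "r = min e r0"
  have h: "r > 0" "h holomorphic_on ball \<rho> r" "\<And>z. z \<in> ball \<rho> r \<Longrightarrow> f z = (z - \<rho>) ^ n * h z" "ball \<rho> r \<subseteq> S"
    using h0 e by (auto simp: r_def elim!: holomorphic_on_subset)
  define g where "g z = (if z \<in> ball \<rho> r then h z else f z / (z - \<rho>) ^ n)" for z
  have g1: "g z = f z / (z - \<rho>) ^ n" if "z \<noteq> \<rho>" for z
    using that h(3)[of z] by (auto simp: g_def)
  have "g holomorphic_on ball \<rho> r"
    using h(2) by (rule holomorphic_transform) (auto simp: g_def)
  moreover have "g holomorphic_on (S - {\<rho>})"
  proof (rule holomorphic_transform)
    show "(\<lambda>z. f z / (z - \<rho>) ^ n) holomorphic_on (S - {\<rho>})"
      using assms(2) by (intro holomorphic_intros) (auto elim!: holomorphic_on_subset)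
  qed (simp add: g1)
  ultimately have "g holomorphic_on (ball \<rho> r \<union> (S - {\<rho>}))"
    using assms(1) by (intro holomorphic_on_Un) auto
  hence "g holomorphic_on S" by (rule holomorphic_on_subset) (use h in auto)
  moreover have "f z = (z - \<rho>) ^ n * g z" if "z \<in> S" for z
    using h(3)[of z] h(1) by (cases "z = \<rho>") (auto simp: g1 g_def)
  ultimately show ?thesis using that by blast
qed

text \<open>The zeros are divided out one at a time. The powers already removed do not vanish at the
  next zero, so its order passes to the remaining cofactor.\<close>

lemma vanishes_to_factorization:
  assumes "finite Z" "open S" "f holomorphic_on S" "Z \<subseteq> S" "\<And>\<rho>. \<rho> \<in> Z \<Longrightarrow> vanishes_to f \<rho> (m \<rho>)"
  shows "\<exists>g. g holomorphic_on S \<and> (\<forall>z\<in>S. f z = (\<Prod>\<rho>\<in>Z. (z - \<rho>) ^ m \<rho>) * g z)"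
  using assms(1,4,5)
proof (induction Z rule: finite_induct)
  case empty
  thus ?case using assms(3) by auto
next
  case (insert \<rho> Z)
  then obtain g where g: "g holomorphic_on S" "\<And>z. z \<in> S \<Longrightarrow> f z = (\<Prod>\<rho>\<in>Z. (z - \<rho>) ^ m \<rho>) * g z"
    by auto
  have "vanishes_to g \<rho> (m \<rho>)"
  proof (rule vanishes_to_cancel[OF _ assms(2) _ _ _ g(2)])
    show "(\<lambda>z. \<Prod>\<rho>\<in>Z. (z - \<rho>) ^ m \<rho>) holomorphic_on S" by (intro holomorphic_intros)
    show "(\<Prod>\<rho>'\<in>Z. (\<rho> - \<rho>') ^ m \<rho>') \<noteq> 0" using insert by auto
  qed (use insert in auto)
  then obtain g' where "g' holomorphic_on S" "\<And>z. z \<in> S \<Longrightarrow> g z = (z - \<rho>) ^ m \<rho> * g' z"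
    using vanishes_to_divide[OF assms(2) g(1), of \<rho> "m \<rho>"] insert by auto
  thus ?case using g insert by (intro exI[of _ g']) (auto simp: mult_ac)
qed

text \<open>The point \<open>w\<close> excludes that \<open>f\<close> vanishes identically on the
  connected set \<open>S\<close>; hence \<open>zorder\<close> is the true order, which is 0 where
  \<open>f \<rho> \<noteq> 0\<close>.\<close>

lemma vanishes_to_zorder:
  assumes "f holomorphic_on S" "open S" "connected S" "\<rho> \<in> S" "w \<in> S" "f w \<noteq> 0"
  shows "vanishes_to f \<rho> (nat (zorder f \<rho>))" "zorder f \<rho> \<ge> 0"
proof -
  have *: "(if f \<rho> = 0 then zorder f \<rho> > 0 else zorder f \<rho> = 0) \<and>
     (\<exists>r>0. cball \<rho> r \<subseteq> S \<and> zor_poly f \<rho> holomorphic_on cball \<rho> r \<and>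
       (\<forall>w\<in>cball \<rho> r. f w = zor_poly f \<rho> w * (w - \<rho>) ^ nat (zorder f \<rho>) \<and> zor_poly f \<rho> w \<noteq> 0))"
    using assms by (intro zorder_exist_zero) auto
  thus "zorder f \<rho> \<ge> 0" by (auto split: if_splits)
  from * obtain r where r: "r > 0" "zor_poly f \<rho> holomorphic_on cball \<rho> r"
     "\<forall>w\<in>cball \<rho> r. f w = zor_poly f \<rho> w * (w - \<rho>) ^ nat (zorder f \<rho>)" by blast
  show "vanishes_to f \<rho> (nat (zorder f \<rho>))" unfolding vanishes_to_def
  proof (intro exI conjI ballI)
    show "r > 0" by fact
    show "zor_poly f \<rho> holomorphic_on ball \<rho> r" using r(2) by (rule holomorphic_on_subset) auto
    fix z assume "z \<in> ball \<rho> r"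
    thus "f z = (z - \<rho>) ^ nat (zorder f \<rho>) * zor_poly f \<rho> z"
      using r(3) by (auto simp: mult.commute)
  qed
qed

text \<open>Serves to carry zeros left of the critical line to the right: \<open>\<rho>\<close> and
  \<open>d - \<rho>\<close> lie symmetrically about \<open>d / 2\<close>, and the factor
  \<open>P\<close> does not vanish at \<open>\<rho>\<close>. The substitution produces the sign
  \<open>(-1) ^ n\<close>.\<close>

lemma vanishes_to_reflect:
  assumes "vanishes_to f \<rho> n" "open S" "\<rho> \<in> S" "P holomorphic_on S" "P \<rho> \<noteq> 0"
    and eq: "\<And>z. z \<in> S \<Longrightarrow> f z = P z * g (d - z)"
  shows "vanishes_to g (d - \<rho>) n"
proof -
  have "vanishes_to (\<lambda>z. g (d - z)) \<rho> n" by (rule vanishes_to_cancel[OF assms])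
  then obtain h r where h: "r > 0" "h holomorphic_on ball \<rho> r" "\<And>z. z \<in> ball \<rho> r \<Longrightarrow> g (d - z) = (z - \<rho>) ^ n * h z"
    unfolding vanishes_to_def by blast
  have im: "d - z \<in> ball \<rho> r" if "z \<in> ball (d - \<rho>) r" for z
    using that by (simp add: dist_norm norm_minus_commute algebra_simps)
  show ?thesis unfolding vanishes_to_def
  proof (intro exI conjI ballI)
    show "r > 0" by fact
    have "(h \<circ> (\<lambda>z. d - z)) holomorphic_on ball (d - \<rho>) r"
      using h(2) im by (intro holomorphic_on_compose_gen[where t = "ball \<rho> r"] holomorphic_intros) auto
    thus "(\<lambda>z. (-1) ^ n * h (d - z)) holomorphic_on ball (d - \<rho>) r"
      unfolding o_def by (intro holomorphic_intros)
    fix z assume z: "z \<in> ball (d - \<rho>) r"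
    have "g z = (-(z - (d - \<rho>))) ^ n * h (d - z)" using h(3)[OF im[OF z]] by (simp add: algebra_simps)
    thus "g z = (z - (d - \<rho>)) ^ n * ((-1) ^ n * h (d - z))"
      by (subst (asm) power_minus) (simp add: mult_ac)
  qed
qed

text \<open>The point \<open>of_real (2 * x) - cnj \<rho>\<close> is the mirror image of
  \<open>\<rho>\<close> in the line \<open>Re s = x\<close>. The last term is 0 for \<open>s\<close>
  on the line and positive when \<open>s\<close> and \<open>\<rho>\<close> lie strictly on the same
  side.\<close>

lemma norm_sub_reflection:
  "norm (s - (of_real (2 * x) - cnj \<rho>)) ^ 2 = norm (s - \<rho>) ^ 2 + 4 * (Re s - x) * (Re \<rho> - x)"
  unfolding cmod_power2 by (simp add: power2_eq_square algebra_simps)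

text \<open>Moving \<open>\<rho>\<close> to its mirror image does not change \<open>\<bar>f\<bar>\<close> on the line; it costs a factor at most
  \<open>exp (k1 * \<eta> \<rho>)\<close> on the arc and gains at least \<open>exp (k2 * \<eta> \<rho>)\<close> at \<open>c + b\<close>. The radius \<open>22 b\<close> is
  large enough for \<open>k2 - k1 \<ge> 1 / (9 b)\<close>.\<close>

lemma half_disc_zeros:
  fixes f :: "complex \<Rightarrow> complex" and c :: complex and m :: "complex \<Rightarrow> nat"
  assumes b: "b > 0" and S: "open S" and f: "f holomorphic_on S"
    and D: "\<And>s. Re s \<ge> Re c \<Longrightarrow> dist c s \<le> 22 * b \<Longrightarrow> s \<in> S"
    and M: "\<And>s. Re s \<ge> Re c \<Longrightarrow> dist c s \<le> 22 * b \<Longrightarrow> norm (f s) \<le> M"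
    and m0: "m0 > 0" "m0 \<le> norm (f (c + of_real b))"
    and Z: "finite Z" "\<And>\<rho>. \<rho> \<in> Z \<Longrightarrow> Re \<rho> > Re c \<and> dist c \<rho> \<le> 2 * b \<and> vanishes_to f \<rho> (m \<rho>)"
  shows "(\<Sum>\<rho>\<in>Z. m \<rho> * (Re \<rho> - Re c)) \<le> 9 * b * ln (M / m0)"
proof -
  have Zin: "\<rho> \<in> S" if "\<rho> \<in> Z" for \<rho>
    using Z(2)[OF that] b by (intro D) auto
  obtain g where g: "g holomorphic_on S" "\<And>z. z \<in> S \<Longrightarrow> f z = (\<Prod>\<rho>\<in>Z. (z - \<rho>) ^ m \<rho>) * g z"
    using vanishes_to_factorization[OF Z(1) S f, of m] Zin Z(2) by blast
  define R where "R = 22 * b"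
  define D where "D = {s. Re s \<ge> Re c} \<inter> cball c R"
  define \<rho>' where "\<rho>' \<rho> = of_real (2 * Re c) - cnj \<rho>" for \<rho>
  \<comment> \<open>\<open>h\<close> is \<open>f\<close> with all zeros in \<open>Z\<close> moved to
    their mirror images. It keeps the cofactor \<open>g\<close>, so the two can be compared factor
    by factor.\<close>
  define h where "h s = (\<Prod>\<rho>\<in>Z. (s - \<rho>' \<rho>) ^ m \<rho>) * g s" for s
  define \<eta> where "\<eta> \<rho> = Re \<rho> - Re c" for \<rho>
  define \<Sigma> where "\<Sigma> = (\<Sum>\<rho>\<in>Z. m \<rho> * \<eta> \<rho>)"
  have DS: "D \<subseteq> S" using D unfolding D_def R_def by auto
  have Dc: "closed D" unfolding D_def by (intro closed_Int closed_halfspace_Re_ge closed_cball)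
  have sq: "norm (s - \<rho>' \<rho>) ^ 2 = norm (s - \<rho>) ^ 2 + 4 * (Re s - Re c) * \<eta> \<rho>" for s \<rho>
    unfolding \<rho>'_def \<eta>_def by (rule norm_sub_reflection)
  have hn: "norm (h s) = (\<Prod>\<rho>\<in>Z. norm (s - \<rho>' \<rho>) ^ m \<rho>) * norm (g s)" for s
    unfolding h_def by (simp add: norm_mult norm_power flip: prod_norm)
  have fn: "norm (f s) = (\<Prod>\<rho>\<in>Z. norm (s - \<rho>) ^ m \<rho>) * norm (g s)" if "s \<in> S" for s
    unfolding g(2)[OF that] by (simp add: norm_mult norm_power flip: prod_norm)
  have expS: "exp (k * \<Sigma>) = (\<Prod>\<rho>\<in>Z. exp (k * \<eta> \<rho>) ^ m \<rho>)" for k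
    unfolding \<Sigma>_def sum_distrib_left exp_sum[OF Z(1)] exp_of_nat_mult[symmetric]
    by (simp add: mult_ac)
  \<comment> \<open>On the arc \<open>norm (s - \<rho>) \<ge> 20 * b\<close> and
    \<open>Re s - Re c \<le> 22 * b\<close>, so the squared distance grows relatively by at most
    \<open>4 * 22 * b * \<eta> \<rho> / (20 * b) ^ 2 = 2 * k1 * \<eta> \<rho>\<close>. At
    \<open>c + b\<close> the mirror image is at distance at most \<open>3 * b\<close>, which gives
    \<open>4 * b * \<eta> \<rho> / (3 * b) ^ 2 = 2 * k2 * \<eta> \<rho>\<close> as relative
    gain.\<close>
  define k1 where "k1 = 11 / (100 * b)"
  define k2 where "k2 = 2 / (9 * b)"
  have eta: "\<eta> \<rho> > 0" if "\<rho> \<in> Z" for \<rho> using Z(2)[OF that] by (simp add: \<eta>_def)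
  have bd: "norm (s - \<rho>' \<rho>) \<le> norm (s - \<rho>) * exp (k1 * \<eta> \<rho>)" if s: "s \<in> frontier D" and \<rho>: "\<rho> \<in> Z" for s \<rho>
  proof (rule power2_le_imp_le)
    have sD: "s \<in> D" using s Dc frontier_subset_closed by blast
    have alt: "Re s = Re c \<or> dist c s = R"
    proof (rule ccontr)
      assume "\<not> (Re s = Re c \<or> dist c s = R)"
      hence "s \<in> {s. Re s > Re c} \<inter> ball c R" using sD by (auto simp: D_def)
      moreover have "open ({s. Re s > Re c} \<inter> ball c R)"
        by (intro open_Int open_halfspace_Re_gt open_ball)
      moreover have "{s. Re s > Re c} \<inter> ball c R \<subseteq> D" by (auto simp: D_def)
      ultimately have "s \<in> interior D" by (meson interiorI)
      thus False using s by (simp add: frontier_def)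
    qed
    have "4 * (Re s - Re c) * \<eta> \<rho> \<le> norm (s - \<rho>) ^ 2 * (2 * k1 * \<eta> \<rho>)"
      using alt
    proof
      assume "Re s = Re c" thus ?thesis using eta[OF \<rho>] b by (simp add: k1_def)
    next
      assume d: "dist c s = R"
      have "R \<le> dist c \<rho> + dist \<rho> s" unfolding d[symmetric] by (rule dist_triangle)
      hence "norm (s - \<rho>) \<ge> 20 * b" using Z(2)[OF \<rho>] by (simp add: R_def dist_norm norm_minus_commute)
      hence 1: "norm (s - \<rho>) ^ 2 \<ge> (20 * b) ^ 2" using b by (intro power_mono) auto
      have "Re s - Re c \<le> R" using complex_Re_le_cmod[of "s - c"] d by (simp add: dist_norm norm_minus_commute)
      hence "4 * (Re s - Re c) * \<eta> \<rho> \<le> 4 * R * \<eta> \<rho>" using eta[OF \<rho>] by (intro mult_right_mono) auto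
      also have "\<dots> = (20 * b) ^ 2 * (2 * k1 * \<eta> \<rho>)" using b by (simp add: R_def k1_def power2_eq_square field_simps)
      also have "\<dots> \<le> norm (s - \<rho>) ^ 2 * (2 * k1 * \<eta> \<rho>)"
        using 1 eta[OF \<rho>] b by (intro mult_right_mono) (auto simp: k1_def)
      finally show ?thesis .
    qed
    hence "norm (s - \<rho>' \<rho>) ^ 2 \<le> norm (s - \<rho>) ^ 2 * (1 + 2 * k1 * \<eta> \<rho>)"
      unfolding sq by (simp add: algebra_simps)
    also have "\<dots> \<le> norm (s - \<rho>) ^ 2 * exp (2 * k1 * \<eta> \<rho>)"
      using exp_ge_add_one_self by (intro mult_left_mono) auto
    also have "\<dots> = (norm (s - \<rho>) * exp (k1 * \<eta> \<rho>)) ^ 2"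
      by (simp add: power_mult_distrib power2_eq_square mult_exp_exp)
    finally show "norm (s - \<rho>' \<rho>) ^ 2 \<le> (norm (s - \<rho>) * exp (k1 * \<eta> \<rho>)) ^ 2" .
  qed auto
  define c1 where "c1 = c + of_real b"
  have c1D: "c1 \<in> D" using b by (simp add: c1_def D_def R_def dist_norm)
  \<comment> \<open>The maximum modulus principle carries the bound for \<open>h\<close> from the
    frontier of the half disc to \<open>c1\<close>.\<close>
  have M1: "norm (h c1) \<le> M * exp (k1 * \<Sigma>)"
  proof (rule maximum_modulus_frontier[of h D])
    have hS: "h holomorphic_on S" unfolding h_def using g(1) by (intro holomorphic_intros)
    show "h holomorphic_on interior D" using hS by (rule holomorphic_on_subset) (use DS interior_subset in blast)
    show "continuous_on (closure D) h" using Dc DS hS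
      by (metis closure_closed continuous_on_subset holomorphic_on_imp_continuous_on)
    show "bounded D" unfolding D_def by (rule bounded_Int) auto
    show "c1 \<in> D" by fact
    fix s assume s: "s \<in> frontier D"
    hence sD: "s \<in> D" using Dc frontier_subset_closed by blast
    have "norm (h s) \<le> (\<Prod>\<rho>\<in>Z. (norm (s - \<rho>) * exp (k1 * \<eta> \<rho>)) ^ m \<rho>) * norm (g s)"
      unfolding hn using bd[OF s] by (intro mult_right_mono prod_mono conjI power_mono) auto
    also have "\<dots> = norm (f s) * exp (k1 * \<Sigma>)"
      using DS sD by (subst fn) (auto simp: expS power_mult_distrib prod.distrib)
    also have "\<dots> \<le> M * exp (k1 * \<Sigma>)"
      using sD by (intro mult_right_mono M) (auto simp: D_def R_def)
    finally show "norm (h s) \<le> M * exp (k1 * \<Sigma>)" .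
  qed
  have bd2: "norm (c1 - \<rho>) * exp (k2 * \<eta> \<rho>) \<le> norm (c1 - \<rho>' \<rho>)" if \<rho>: "\<rho> \<in> Z" for \<rho>
  proof (rule power2_le_imp_le)
    define N where "N = norm (c1 - \<rho>' \<rho>)"
    have "norm (c - \<rho>' \<rho>) ^ 2 = norm (c - \<rho>) ^ 2" unfolding sq by simp
    hence "norm (c - \<rho>' \<rho>) = norm (c - \<rho>)" by (simp add: power2_eq_iff_nonneg)
    hence "N \<le> 3 * b"
      using norm_triangle_ineq[of "c - \<rho>' \<rho>" "of_real b"] Z(2)[OF \<rho>] b
      by (simp add: N_def c1_def dist_norm algebra_simps)
    hence N2: "N ^ 2 \<le> (3 * b) ^ 2" by (intro power_mono) (auto simp: N_def)
    have "norm (c1 - \<rho>) ^ 2 = N ^ 2 - 4 * b * \<eta> \<rho>" unfolding N_def sq by (simp add: c1_def)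
    also have "4 * b * \<eta> \<rho> = (3 * b) ^ 2 * (2 * k2 * \<eta> \<rho>)" using b by (simp add: k2_def power2_eq_square field_simps)
    also have "N ^ 2 - \<dots> \<le> N ^ 2 - N ^ 2 * (2 * k2 * \<eta> \<rho>)"
      using N2 eta[OF \<rho>] b by (intro diff_left_mono mult_right_mono) (auto simp: k2_def)
    also have "\<dots> = N ^ 2 * (1 + (- (2 * k2 * \<eta> \<rho>)))" by (simp add: algebra_simps)
    also have "\<dots> \<le> N ^ 2 * exp (- (2 * k2 * \<eta> \<rho>))"
      by (intro mult_left_mono exp_ge_add_one_self) auto
    finally have "norm (c1 - \<rho>) ^ 2 * exp (2 * k2 * \<eta> \<rho>) \<le> N ^ 2"
      by (simp add: exp_minus field_simps)
    moreover have "norm (c1 - \<rho>) ^ 2 * exp (2 * k2 * \<eta> \<rho>) = (norm (c1 - \<rho>) * exp (k2 * \<eta> \<rho>)) ^ 2"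
      by (simp add: power_mult_distrib power2_eq_square mult_exp_exp)
    ultimately show "(norm (c1 - \<rho>) * exp (k2 * \<eta> \<rho>)) ^ 2 \<le> norm (c1 - \<rho>' \<rho>) ^ 2"
      by (simp add: N_def)
  qed auto
  \<comment> \<open>At \<open>c1\<close> the modulus of \<open>h\<close> is at least
    \<open>exp (k2 * \<Sigma>)\<close> times that of \<open>f\<close>, while \<open>M1\<close>
    bounds it by \<open>M * exp (k1 * \<Sigma>)\<close>. Hence
    \<open>exp ((k2 - k1) * \<Sigma>)\<close> is at most \<open>M / m0\<close>.\<close>
  have "norm (f c1) * exp (k2 * \<Sigma>) = (\<Prod>\<rho>\<in>Z. (norm (c1 - \<rho>) * exp (k2 * \<eta> \<rho>)) ^ m \<rho>) * norm (g c1)"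
    using DS c1D by (subst fn) (auto simp: expS power_mult_distrib prod.distrib)
  also have "\<dots> \<le> norm (h c1)"
    unfolding hn using bd2 by (intro mult_right_mono prod_mono conjI power_mono) auto
  also note M1
  finally have "norm (f c1) * exp (k2 * \<Sigma>) \<le> M * exp (k1 * \<Sigma>)" .
  hence "m0 * exp (k2 * \<Sigma>) \<le> M * exp (k1 * \<Sigma>)"
    using m0(2) unfolding c1_def[symmetric] by (meson exp_ge_zero mult_right_mono order_trans)
  hence le: "exp (k2 * \<Sigma> - k1 * \<Sigma>) \<le> M / m0" using m0(1) by (simp add: exp_diff field_simps)
  have "\<Sigma> \<ge> 0" unfolding \<Sigma>_def using eta by (intro sum_nonneg) (simp add: less_imp_le)
  have "\<Sigma> / (9 * b) \<le> k2 * \<Sigma> - k1 * \<Sigma>"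
    using \<open>\<Sigma> \<ge> 0\<close> b by (simp add: k1_def k2_def field_simps)
  also have "\<dots> \<le> ln (M / m0)"
    using le by (metis exp_gt_zero ln_exp ln_mono order_less_le_trans)
  finally show ?thesis using b by (simp add: \<Sigma>_def \<eta>_def field_simps)
qed

text \<open>The strip is cut into boxes of unit height, and \<open>half_disc_zeros\<close> is
  applied with its centre on the line \<open>Re s = x\<close> at the lower edge of each box. Since
  \<open>b \<ge> 1\<close>, the zeros in a box are within \<open>b + 1 \<le> 2 * b\<close> of the
  centre. The margin \<open>22 * b\<close> makes room for the half discs.\<close>

lemma strip_zeros:
  fixes f :: "complex \<Rightarrow> complex" and m :: "complex \<Rightarrow> nat"
  assumes b: "b \<ge> 1" and U: "U > 0" and S: "open S" and f: "f holomorphic_on S"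
    and D: "\<And>s. Re s \<ge> x \<Longrightarrow> V - 22 * b \<le> Im s \<Longrightarrow> Im s \<le> V + U + 22 * b \<Longrightarrow> s \<in> S \<and> norm (f s) \<le> M"
    and m0: "m0 > 0" "\<And>s. Re s = x + b \<Longrightarrow> V \<le> Im s \<Longrightarrow> Im s \<le> V + U \<Longrightarrow> m0 \<le> norm (f s)"
    and Z: "finite Z" "\<And>\<rho>. \<rho> \<in> Z \<Longrightarrow> x < Re \<rho> \<and> Re \<rho> \<le> x + b \<and> V < Im \<rho> \<and> Im \<rho> < V + U \<and> vanishes_to f \<rho> (m \<rho>)"
  shows "(\<Sum>\<rho>\<in>Z. m \<rho> * (Re \<rho> - x)) \<le> (U + 1) * (9 * b * ln (M / m0))"
proof -
  define J where "J \<rho> = nat \<lfloor>Im \<rho> - V\<rfloor>" for \<rho>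
  define n where "n = nat \<lfloor>U\<rfloor>"
  define L where "L = 9 * b * ln (M / m0)"
  have nU: "real n \<le> U" using U unfolding n_def by linarith
  have each: "(\<Sum>\<rho>\<in>{\<rho>\<in>Z. J \<rho> = j}. m \<rho> * (Re \<rho> - x)) \<le> L" if j: "j \<le> n" for j
  proof -
    define c where "c = Complex x (V + real j)"
    have jU: "real j \<le> U" using j nU by linarith
    have im: "\<bar>Im s - Im c\<bar> \<le> 22 * b" if "dist c s \<le> 22 * b" for s
      using abs_Im_le_cmod[of "c - s"] that by (simp add: dist_norm)
    have "(\<Sum>\<rho>\<in>{\<rho>\<in>Z. J \<rho> = j}. m \<rho> * (Re \<rho> - Re c)) \<le> 9 * b * ln (M / m0)"
    proof (rule half_disc_zeros[OF _ S f])
      show "b > 0" using b by simp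
      fix s assume "Re c \<le> Re s" "dist c s \<le> 22 * b"
      thus "s \<in> S" "norm (f s) \<le> M" using D[of s] im[of s] jU by (auto simp: c_def)
    next
      show "m0 > 0" by fact
      show "m0 \<le> norm (f (c + of_real b))" using jU U by (intro m0) (auto simp: c_def)
      show "finite {\<rho>\<in>Z. J \<rho> = j}" using Z(1) by simp
      fix \<rho> assume \<rho>: "\<rho> \<in> {\<rho>\<in>Z. J \<rho> = j}"
      hence "\<bar>Im \<rho> - V - real j\<bar> \<le> 1" using Z(2)[of \<rho>] unfolding J_def by auto linarith+
      hence "dist c \<rho> \<le> b + 1"
        using cmod_le[of "\<rho> - c"] Z(2)[of \<rho>] \<rho> by (auto simp: norm_minus_commute dist_norm c_def algebra_simps)
      thus "Re c < Re \<rho> \<and> dist c \<rho> \<le> 2 * b \<and> vanishes_to f \<rho> (m \<rho>)"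
        using Z(2)[of \<rho>] \<rho> b by (simp add: c_def)
    qed
    thus ?thesis by (simp add: c_def L_def)
  qed
  \<comment> \<open>\<open>L\<close> bounds a sum of nonnegative terms. Its sign matters when the
    number \<open>n + 1\<close> of boxes is replaced by \<open>U + 1\<close>.\<close>
  have L0: "L \<ge> 0"
  proof -
    have "0 \<le> (\<Sum>\<rho>\<in>{\<rho>\<in>Z. J \<rho> = 0}. m \<rho> * (Re \<rho> - x))"
      using Z(2) by (intro sum_nonneg) (force intro: mult_nonneg_nonneg)
    thus ?thesis using each[of 0] by linarith
  qed
  have "(\<Sum>\<rho>\<in>Z. m \<rho> * (Re \<rho> - x)) = (\<Sum>j\<le>n. \<Sum>\<rho>\<in>{\<rho>\<in>Z. J \<rho> = j}. m \<rho> * (Re \<rho> - x))"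
  proof (rule sum.group[symmetric])
    show "J ` Z \<subseteq> {..n}"
      using Z(2) unfolding J_def n_def by (force intro!: nat_mono floor_mono)
  qed (use Z in auto)
  also have "\<dots> \<le> (\<Sum>j\<le>n. L)" using each by (intro sum_mono) auto
  also have "\<dots> = (real n + 1) * L" by simp
  also have "\<dots> \<le> (U + 1) * L" using nU L0 by (intro mult_right_mono) auto
  finally show ?thesis by (simp add: L_def)
qed

section \<open>Dirichlet polynomials with a reflected term\<close>

lemma norm_dterm: "freq n > 0 \<Longrightarrow> norm (dterm p freq s n) = norm (p n) * freq n powr (- Re s)"
  unfolding dterm_def by (simp add: norm_divide norm_of_real_powr powr_minus_divide)

text \<open>All constants are independent of \<open>N\<close>. The height \<open>T\<^sub>0 * N powr \<gamma>\<close> is chosen such that the decay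
  of \<open>G\<close> absorbs both the growth \<open>freq N powr (Re s - \<delta> / 2)\<close> of the reflected polynomial and its
  coefficients, leaving \<open>O(freq 3 powr - (Re s - \<delta> / 2))\<close>, which is small compared with the second
  term. This matters when \<open>p 1 = 0\<close>.\<close>

lemma dirichlet_pair_bounds:
  fixes p q :: "nat \<Rightarrow> complex" and freq :: "nat \<Rightarrow> real" and G :: "complex \<Rightarrow> complex"
  assumes G1: "C \<ge> 1" "L \<ge> 1" "e > 0" "y \<ge> 1" "\<tau>\<^sub>0 > 0"
    and G2: "\<And>s. \<bar>Im s\<bar> \<ge> y \<Longrightarrow> Re s \<ge> \<delta> / 2 \<Longrightarrow> norm (G s) \<le> C * L powr (Re s - \<delta> / 2)"
    and G3: "\<And>s. \<bar>Im s\<bar> \<ge> y \<Longrightarrow> Re s \<ge> \<delta> / 2 + \<tau>\<^sub>0 \<Longrightarrow>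
       norm (G s) \<le> C * (L * \<bar>Im s\<bar> powr (- e)) powr (Re s - \<delta> / 2)"
    and freq: "strict_mono_on {1..} freq" "freq 1 = 1"
    and KB: "K \<ge> 1" "B \<ge> 0" "\<And>n. n \<ge> 1 \<Longrightarrow> freq n \<le> K * real n powr B"
      "\<And>n. n \<ge> 1 \<Longrightarrow> norm (p n) \<le> K * real n powr B" "\<And>n. n \<ge> 1 \<Longrightarrow> norm (q n) \<le> K * real n powr B"
    and A: "\<And>N. (\<Sum>n=3..N. norm (p n) * freq n powr (- \<sigma>\<^sub>1)) \<le> A"
    and p2: "p 2 \<noteq> 0"
  obtains T\<^sub>0 \<gamma> b M E c r :: real where "T\<^sub>0 > 0" "\<gamma> > 0" "b \<ge> 1" "M \<ge> 1" "E \<ge> 0" "c > 0" "r \<ge> 1"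
    "\<And>N s. N \<ge> 2 \<Longrightarrow> \<bar>Im s\<bar> \<ge> T\<^sub>0 * real N powr \<gamma> \<Longrightarrow> Re s \<ge> \<delta> / 2 \<Longrightarrow>
       norm (F_trunc p freq N s + G s * F_trunc q freq N (of_real \<delta> - s)) \<le> M * real N powr E"
    "\<And>N s. N \<ge> 2 \<Longrightarrow> \<bar>Im s\<bar> \<ge> T\<^sub>0 * real N powr \<gamma> \<Longrightarrow> Re s \<ge> \<delta> / 2 + b \<Longrightarrow>
       norm (F_trunc p freq N s + G s * F_trunc q freq N (of_real \<delta> - s)) \<ge> c * r powr (- (Re s - \<delta> / 2))"
proof -
  have fmono: "freq m \<le> freq n" if "1 \<le> m" "m \<le> n" for m n
    using strict_mono_onD[OF freq(1), of m n] that by (cases "m = n") auto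
  have f1: "freq n \<ge> 1" if "n \<ge> 1" for n using fmono[of 1 n] freq(2) that by simp
  have f2: "freq 2 > 1" using strict_mono_onD[OF freq(1), of 1 2] freq(2) by simp
  have f3: "freq 3 > freq 2" using strict_mono_onD[OF freq(1), of 2 3] by simp
  \<comment> \<open>\<open>P\<close> and \<open>E1\<close> come from the trivial bound of a
    truncated series: \<open>N\<close> terms, coefficients at most \<open>K * N powr B\<close>, and
    the power \<open>\<bar>\<delta>\<bar> / 2\<close> of
    \<open>freq N \<le> K * N powr B\<close>.\<close>
  define P where "P = K * K powr (\<bar>\<delta>\<bar> / 2)"
  define E1 where "E1 = 1 + B + B * (\<bar>\<delta>\<bar> / 2)"
  have E1: "E1 \<ge> 1" using KB by (simp add: E1_def)
  have P1: "P \<ge> 1" unfolding P_def using KB(1) mult_mono[of 1 K 1 "K powr (\<bar>\<delta>\<bar> / 2)"]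
    by (simp add: ge_one_powr_ge_zero)
  \<comment> \<open>One bound serves both polynomials: \<open>\<tau> = 0\<close> for the one at
    \<open>s\<close>, and \<open>\<tau>\<close> at least the distance of \<open>s\<close> from the
    critical line for the one at \<open>\<delta> - s\<close>.\<close>
  have trunc: "norm (F_trunc v freq N s) \<le> P * real N powr E1 * freq N powr \<tau>"
    if N: "N \<ge> 1" and v: "\<And>n. n \<ge> 1 \<Longrightarrow> norm (v n) \<le> K * real n powr B"
      and s: "- Re s \<le> \<bar>\<delta>\<bar> / 2 + \<tau>" "\<tau> \<ge> 0" for v N s \<tau>
  proof -
    have "norm (F_trunc v freq N s) \<le> (\<Sum>n=1..N. norm (dterm v freq s n))"
      unfolding F_trunc_def by (rule norm_sum)
    also have "\<dots> \<le> (\<Sum>n=1..N. K * real N powr B * (freq N powr (\<bar>\<delta>\<bar> / 2) * freq N powr \<tau>))"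
    proof (rule sum_mono)
      fix n assume n: "n \<in> {1..N}"
      have fn: "freq n \<ge> 1" using f1 n by simp
      have "norm (dterm v freq s n) = norm (v n) * freq n powr (- Re s)" using fn by (intro norm_dterm) auto
      also have "\<dots> \<le> (K * real n powr B) * freq n powr (\<bar>\<delta>\<bar> / 2 + \<tau>)"
        using n v fn s KB(1) by (intro mult_mono powr_mono) auto
      also have "\<dots> \<le> (K * real N powr B) * freq N powr (\<bar>\<delta>\<bar> / 2 + \<tau>)"
        using n KB fn s fmono by (intro mult_mono powr_mono2 mult_left_mono) auto
      finally show "norm (dterm v freq s n) \<le> K * real N powr B * (freq N powr (\<bar>\<delta>\<bar> / 2) * freq N powr \<tau>)"
        by (simp add: powr_add)
    qed
    also have "\<dots> = real N * (K * real N powr B * (freq N powr (\<bar>\<delta>\<bar> / 2) * freq N powr \<tau>))" by simp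
    also have "\<dots> \<le> real N * (K * real N powr B * ((K * real N powr B) powr (\<bar>\<delta>\<bar> / 2) * freq N powr \<tau>))"
      using KB N f1[of N] by (intro mult_left_mono mult_right_mono powr_mono2) auto
    also have "\<dots> = P * real N powr E1 * freq N powr \<tau>"
      using KB N unfolding P_def E1_def by (simp add: powr_mult powr_powr powr_add)
    finally show ?thesis .
  qed
  \<comment> \<open>The choice gives
    \<open>t powr e \<ge> W * N powr (E1 / \<tau>\<^sub>0 + B)\<close>, that is,
    \<open>L * t powr (- e) * freq N\<close> is at most
    \<open>1 / (freq 3 * N powr (E1 / \<tau>\<^sub>0))\<close>. Raised to a power
    \<open>\<tau> \<ge> \<tau>\<^sub>0\<close>, this cancels \<open>N powr E1\<close> and leaves
    \<open>freq 3 powr (- \<tau>)\<close>. The summand \<open>y\<close> of \<open>T\<close> makes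
    the bounds on \<open>G\<close> available.\<close>
  define W where "W = L * K * freq 3"
  define \<gamma> where "\<gamma> = (E1 / \<tau>\<^sub>0 + B) / e"
  define T where "T = y + W powr (1 / e)"
  have W1: "W > 0" unfolding W_def using G1 KB f2 f3 by simp
  have \<gamma>: "\<gamma> > 0" unfolding \<gamma>_def using E1 G1 KB by (intro divide_pos_pos add_pos_nonneg) auto
  have T: "T > 0" unfolding T_def using G1 by (intro add_pos_nonneg) auto
  have ty: "t \<ge> y" if "N \<ge> 1" "t \<ge> T * real N powr \<gamma>" for N t
  proof -
    have "real N powr \<gamma> \<ge> 1" using that(1) \<gamma> by (simp add: ge_one_powr_ge_zero)
    hence "T * real N powr \<gamma> \<ge> T * 1" using T by (intro mult_left_mono) auto
    thus ?thesis using that(2) unfolding T_def by (smt (verit) powr_ge_zero)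
  qed
  have decay: "norm (G s * F_trunc q freq N (of_real \<delta> - s)) \<le> C * P * freq 3 powr (- (Re s - \<delta> / 2))"
    if N: "N \<ge> 1" and t: "\<bar>Im s\<bar> \<ge> T * real N powr \<gamma>" and \<sigma>: "Re s \<ge> \<delta> / 2 + \<tau>\<^sub>0" for N s
  proof -
    define \<tau> where "\<tau> = Re s - \<delta> / 2"
    define t where "t = \<bar>Im s\<bar>"
    have t0: "t > 0" using ty[OF N t] G1 by (simp add: t_def)
    have \<tau>: "\<tau> \<ge> \<tau>\<^sub>0" "\<tau> > 0" using \<sigma> G1 by (auto simp: \<tau>_def)
    have "W powr (1 / e) * real N powr \<gamma> \<le> T * real N powr \<gamma>"
      using G1 by (intro mult_right_mono) (auto simp: T_def)
    hence "(W powr (1 / e) * real N powr \<gamma>) powr e \<le> t powr e"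
      using t G1 by (intro powr_mono2) (auto simp: t_def)
    also have "(W powr (1 / e) * real N powr \<gamma>) powr e = W * real N powr (E1 / \<tau>\<^sub>0 + B)"
      using G1 W1 by (simp add: powr_mult powr_powr \<gamma>_def)
    finally have te: "W * (real N powr (E1 / \<tau>\<^sub>0) * real N powr B) \<le> t powr e" by (simp add: powr_add)
    have Npos: "real N powr x > 0" for x using N by simp
    have "L * t powr (- e) * freq N \<le> L * t powr (- e) * (K * real N powr B)"
      using KB(3)[OF N] G1 by (intro mult_left_mono) auto
    also have "\<dots> \<le> 1 / (freq 3 * real N powr (E1 / \<tau>\<^sub>0))"
    proof -
      have "L * (K * real N powr B) * (freq 3 * real N powr (E1 / \<tau>\<^sub>0)) \<le> t powr e"
        using te by (simp add: W_def mult_ac)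
      thus ?thesis using Npos[of "E1 / \<tau>\<^sub>0"] f2 f3 t0 by (simp add: powr_minus field_simps)
    qed
    finally have le: "L * t powr (- e) * freq N \<le> 1 / (freq 3 * real N powr (E1 / \<tau>\<^sub>0))" .
    have fN: "freq N \<ge> 1" using f1 N by simp
    have "norm (G s * F_trunc q freq N (of_real \<delta> - s)) \<le>
        (C * (L * t powr (- e)) powr \<tau>) * (P * real N powr E1 * freq N powr \<tau>)"
      unfolding norm_mult t_def \<tau>_def using \<sigma> G1 P1 ty[OF N t] KB(5) N
      by (intro mult_mono G3 trunc) (auto simp: abs_if)
    also have "\<dots> = C * P * real N powr E1 * (L * t powr (- e) * freq N) powr \<tau>"
      using fN G1 by (simp add: powr_mult)
    also have "\<dots> \<le> C * P * real N powr E1 * (1 / (freq 3 * real N powr (E1 / \<tau>\<^sub>0))) powr \<tau>"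
      using le \<tau> G1 P1 fN by (intro mult_left_mono powr_mono2) auto
    also have "(1 / (freq 3 * real N powr (E1 / \<tau>\<^sub>0))) powr \<tau> = freq 3 powr (- \<tau>) / real N powr (E1 * (\<tau> / \<tau>\<^sub>0))"
      using f2 f3 by (simp add: powr_divide powr_mult powr_powr powr_minus_divide)
    also have "C * P * real N powr E1 * \<dots> = C * P * freq 3 powr (- \<tau>) * (real N powr E1 / real N powr (E1 * (\<tau> / \<tau>\<^sub>0)))"
      by simp
    also have "\<dots> \<le> C * P * freq 3 powr (- \<tau>) * 1"
    proof (intro mult_left_mono)
      have "E1 * 1 \<le> E1 * (\<tau> / \<tau>\<^sub>0)" using E1 \<tau> G1 by (intro mult_left_mono) auto
      hence "real N powr E1 \<le> real N powr (E1 * (\<tau> / \<tau>\<^sub>0))" using N by (intro powr_mono) auto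
      thus "real N powr E1 / real N powr (E1 * (\<tau> / \<tau>\<^sub>0)) \<le> 1" using N by simp
    qed (use G1 P1 in auto)
    finally show ?thesis by (simp add: \<tau>_def)
  qed
  \<comment> \<open>The parts of \<open>M\<close> belong to the first polynomial, to the reflected
    term within \<open>\<tau>\<^sub>0\<close> of the line, and to the reflected term beyond it,
    where \<open>decay\<close> applies. In the middle part \<open>freq N powr \<tau>\<^sub>0\<close>
    costs the exponent \<open>B * \<tau>\<^sub>0\<close>.\<close>
  define E where "E = E1 + B * \<tau>\<^sub>0"
  define M where "M = P + C * L powr \<tau>\<^sub>0 * P * K powr \<tau>\<^sub>0 + C * P"
  have upper: "norm (F_trunc p freq N s + G s * F_trunc q freq N (of_real \<delta> - s)) \<le> M * real N powr E"
    if N: "N \<ge> 2" and t: "\<bar>Im s\<bar> \<ge> T * real N powr \<gamma>" and \<sigma>: "Re s \<ge> \<delta> / 2" for N s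
  proof -
    have N1: "N \<ge> 1" using N by simp
    have EE: "real N powr E1 \<le> real N powr E" using N1 KB G1 by (intro powr_mono) (auto simp: E_def)
    have E0: "real N powr E \<ge> 1" using N1 E1 KB G1 by (auto intro!: ge_one_powr_ge_zero simp: E_def)
    have fN: "freq N \<ge> 1" using f1 N by simp
    have p: "norm (F_trunc p freq N s) \<le> P * real N powr E"
    proof -
      have "norm (F_trunc p freq N s) \<le> P * real N powr E1 * freq N powr 0"
        using \<sigma> N1 KB(4) by (intro trunc) (auto simp: abs_if)
      also have "\<dots> \<le> P * real N powr E" using EE P1 fN by simp
      finally show ?thesis .
    qed
    have q: "norm (G s * F_trunc q freq N (of_real \<delta> - s)) \<le> (C * L powr \<tau>\<^sub>0 * P * K powr \<tau>\<^sub>0 + C * P) * real N powr E"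
    proof (cases "Re s \<ge> \<delta> / 2 + \<tau>\<^sub>0")
      case True
      have "norm (G s * F_trunc q freq N (of_real \<delta> - s)) \<le> C * P * freq 3 powr (- (Re s - \<delta> / 2))"
        using decay[OF N1 t True] .
      also have "\<dots> \<le> C * P * 1"
      proof (rule mult_left_mono)
        have "freq 3 powr (- (Re s - \<delta> / 2)) \<le> freq 3 powr 0"
          using f2 f3 True G1(5) by (intro powr_mono) auto
        thus "freq 3 powr (- (Re s - \<delta> / 2)) \<le> 1" using f2 f3 by simp
      qed (use G1 P1 in simp)
      also have "\<dots> \<le> C * P * real N powr E" using E0 G1(1) P1 by (intro mult_left_mono) auto
      also have "\<dots> \<le> (C * L powr \<tau>\<^sub>0 * P * K powr \<tau>\<^sub>0 + C * P) * real N powr E"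
        using G1(1) P1 by (intro mult_right_mono) auto
      finally show ?thesis .
    next
      case False
      have "norm (G s * F_trunc q freq N (of_real \<delta> - s)) \<le> (C * L powr (Re s - \<delta> / 2)) * (P * real N powr E1 * freq N powr \<tau>\<^sub>0)"
        unfolding norm_mult using \<sigma> False G1 P1 ty[OF N1 t] KB(5) N1
        by (intro mult_mono G2 trunc) (auto simp: abs_if)
      also have "\<dots> \<le> (C * L powr \<tau>\<^sub>0) * (P * real N powr E1 * (K * real N powr B) powr \<tau>\<^sub>0)"
        using False G1 P1 KB(3)[OF N1] fN KB by (intro mult_mono powr_mono powr_mono2 mult_left_mono) auto
      also have "\<dots> = (C * L powr \<tau>\<^sub>0 * P * K powr \<tau>\<^sub>0) * real N powr E"
        using KB N by (simp add: E_def powr_mult powr_powr powr_add)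
      also have "\<dots> \<le> (C * L powr \<tau>\<^sub>0 * P * K powr \<tau>\<^sub>0 + C * P) * real N powr E"
        using G1 P1 by (intro mult_right_mono) auto
      finally show ?thesis .
    qed
    show ?thesis using norm_triangle_le[OF add_mono[OF p q]] by (simp add: M_def algebra_simps)
  qed
  have M1: "M \<ge> 1"
    using P1 G1 KB unfolding M_def by (smt (verit) mult_nonneg_nonneg powr_ge_zero)
  \<comment> \<open>\<open>A'\<close> measures the tail of the polynomial from \<open>n = 3\<close>
    and the reflected term against the same power of \<open>freq 3\<close>.\<close>
  define A' where "A' = A * freq 3 powr (\<sigma>\<^sub>1 - \<delta> / 2) + C * P"
  have rest: "norm (F_trunc p freq N s + G s * F_trunc q freq N (of_real \<delta> - s) - (p 1 + p 2 / of_real (freq 2) powr s))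
      \<le> A' * freq 3 powr (- (Re s - \<delta> / 2))"
    if N: "N \<ge> 2" and t: "\<bar>Im s\<bar> \<ge> T * real N powr \<gamma>"
      and \<sigma>: "Re s \<ge> \<delta> / 2 + \<tau>\<^sub>0" "Re s \<ge> \<sigma>\<^sub>1" for N s
  proof -
    have "F_trunc p freq N s = p 1 + p 2 / of_real (freq 2) powr s + (\<Sum>n=3..N. dterm p freq s n)"
      unfolding F_trunc_def using N
      by (simp add: sum.atLeast_Suc_atMost numeral_2_eq_2 numeral_3_eq_3 dterm_def freq(2)[simplified])
    hence "F_trunc p freq N s + G s * F_trunc q freq N (of_real \<delta> - s) - (p 1 + p 2 / of_real (freq 2) powr s)
        = (\<Sum>n=3..N. dterm p freq s n) + G s * F_trunc q freq N (of_real \<delta> - s)" by simp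
    also have "norm \<dots> \<le> A * freq 3 powr (\<sigma>\<^sub>1 - Re s) + C * P * freq 3 powr (- (Re s - \<delta> / 2))"
    proof (rule norm_triangle_le[OF add_mono])
      have "norm (\<Sum>n=3..N. dterm p freq s n) \<le> (\<Sum>n=3..N. norm (dterm p freq s n))" by (rule norm_sum)
      also have "\<dots> \<le> (\<Sum>n=3..N. norm (p n) * freq n powr (- \<sigma>\<^sub>1) * freq 3 powr (\<sigma>\<^sub>1 - Re s))"
      proof (rule sum_mono)
        fix n assume n: "n \<in> {3..N}"
        have fn: "freq n \<ge> 1" "freq n \<ge> freq 3" using f1 fmono n by auto
        have "norm (dterm p freq s n) = norm (p n) * (freq n powr (- \<sigma>\<^sub>1) * freq n powr (\<sigma>\<^sub>1 - Re s))"
          using fn by (subst norm_dterm) (auto simp flip: powr_add)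
        also have "\<dots> \<le> norm (p n) * (freq n powr (- \<sigma>\<^sub>1) * freq 3 powr (\<sigma>\<^sub>1 - Re s))"
          using fn f2 f3 \<sigma> by (intro mult_left_mono powr_mono2') auto
        finally show "norm (dterm p freq s n) \<le> norm (p n) * freq n powr (- \<sigma>\<^sub>1) * freq 3 powr (\<sigma>\<^sub>1 - Re s)"
          by (simp add: mult_ac)
      qed
      also have "\<dots> = (\<Sum>n=3..N. norm (p n) * freq n powr (- \<sigma>\<^sub>1)) * freq 3 powr (\<sigma>\<^sub>1 - Re s)"
        by (simp add: sum_distrib_right)
      also have "\<dots> \<le> A * freq 3 powr (\<sigma>\<^sub>1 - Re s)" using A by (intro mult_right_mono) auto
      finally show "norm (\<Sum>n=3..N. dterm p freq s n) \<le> A * freq 3 powr (\<sigma>\<^sub>1 - Re s)" .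
      show "norm (G s * F_trunc q freq N (of_real \<delta> - s)) \<le> C * P * freq 3 powr (- (Re s - \<delta> / 2))"
        using N by (intro decay t \<sigma>) auto
    qed
    also have "\<dots> = A' * freq 3 powr (- (Re s - \<delta> / 2))"
      unfolding A'_def by (simp add: algebra_simps flip: powr_add)
    finally show ?thesis .
  qed
  have to0: "((\<lambda>\<tau>. x powr (- \<tau>)) \<longlongrightarrow> 0) at_top" if "x > 1" for x :: real
  proof -
    have "filterlim (\<lambda>\<tau>. ln x * \<tau>) at_top at_top"
      using that by (intro filterlim_tendsto_pos_mult_at_top[OF tendsto_const _ filterlim_ident]) auto
    hence "filterlim (\<lambda>\<tau>. exp (ln x * \<tau>)) at_top at_top" by (rule filterlim_compose[OF exp_at_top])
    hence "filterlim (\<lambda>\<tau>. x powr \<tau>) at_top at_top" using that by (simp add: powr_def mult.commute)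
    hence "((\<lambda>\<tau>. inverse (x powr \<tau>)) \<longlongrightarrow> 0) at_top" by (rule tendsto_inverse_0_at_top)
    thus ?thesis by (simp add: powr_minus)
  qed
  \<comment> \<open>If \<open>p 1 \<noteq> 0\<close>, the constant term dominates and
    \<open>r = 1\<close>. Otherwise the second term dominates, with \<open>r = freq 2\<close>,
    because \<open>freq 3 / freq 2 > 1\<close>.\<close>
  have lower: "\<exists>c r b0. c > 0 \<and> r \<ge> 1 \<and> (\<forall>N s. N \<ge> 2 \<longrightarrow> \<bar>Im s\<bar> \<ge> T * real N powr \<gamma> \<longrightarrow> Re s \<ge> \<delta> / 2 + b0 \<longrightarrow>
      norm (F_trunc p freq N s + G s * F_trunc q freq N (of_real \<delta> - s)) \<ge> c * r powr (- (Re s - \<delta> / 2)))"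
  proof (cases "p 1 = 0")
    case False
    have "((\<lambda>\<tau>. norm (p 2) * freq 2 powr (- (\<delta> / 2)) * freq 2 powr (- \<tau>) + A' * freq 3 powr (- \<tau>)) \<longlongrightarrow>
        norm (p 2) * freq 2 powr (- (\<delta> / 2)) * 0 + A' * 0) at_top"
      using f2 f3 by (intro tendsto_intros to0) auto
    hence "\<forall>\<^sub>F \<tau> in at_top. norm (p 2) * freq 2 powr (- (\<delta> / 2)) * freq 2 powr (- \<tau>) + A' * freq 3 powr (- \<tau>) < norm (p 1) / 2"
      using False by (intro order_tendstoD) auto
    then obtain b0 where b0: "\<And>\<tau>. \<tau> \<ge> b0 \<Longrightarrow>
        norm (p 2) * freq 2 powr (- (\<delta> / 2)) * freq 2 powr (- \<tau>) + A' * freq 3 powr (- \<tau>) < norm (p 1) / 2"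
      unfolding eventually_at_top_linorder by auto
    show ?thesis
    proof (intro exI conjI allI impI)
      show "norm (p 1) / 2 > 0" using False by simp
      show "(1::real) \<ge> 1" by simp
      \<comment> \<open>The maximum is the witness for \<open>b0\<close>: it also reaches the range
        of \<open>decay\<close> and the abscissa \<open>\<sigma>\<^sub>1\<close> at which the tail
        is summed.\<close>
      fix N s assume N: "(N::nat) \<ge> 2" and t: "\<bar>Im s\<bar> \<ge> T * real N powr \<gamma>"
        and \<sigma>: "Re s \<ge> \<delta> / 2 + max b0 (max \<tau>\<^sub>0 (\<sigma>\<^sub>1 - \<delta> / 2))"
      let ?F = "F_trunc p freq N s + G s * F_trunc q freq N (of_real \<delta> - s)"
      let ?x = "p 2 / of_real (freq 2) powr s"
      have "norm ?x = norm (p 2) * freq 2 powr (- (\<delta> / 2)) * freq 2 powr (- (Re s - \<delta> / 2))"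
        using f2 norm_dterm[of freq 2 p s] by (simp add: dterm_def mult.assoc flip: powr_add)
      moreover have "norm (?F - (p 1 + ?x)) \<le> A' * freq 3 powr (- (Re s - \<delta> / 2))"
        using \<sigma> by (intro rest[OF N t]) auto
      moreover have "norm (p 1) \<le> norm ?F + norm (?F - (p 1 + ?x)) + norm ?x"
        using norm_triangle_ineq4[of "?F - (?F - (p 1 + ?x))" ?x] norm_triangle_ineq4[of ?F "?F - (p 1 + ?x)"] by simp
      moreover have "b0 \<le> Re s - \<delta> / 2" using \<sigma> by linarith
      note b0[OF this]
      ultimately have "norm ?F \<ge> norm (p 1) / 2" by linarith
      thus "norm ?F \<ge> norm (p 1) / 2 * 1 powr (- (Re s - \<delta> / 2))" by simp
    qed
  next
    case True
    define d where "d = norm (p 2) * freq 2 powr (- (\<delta> / 2))"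
    have d: "d > 0" using p2 f2 by (simp add: d_def)
    have "((\<lambda>\<tau>. A' * (freq 3 / freq 2) powr (- \<tau>)) \<longlongrightarrow> A' * 0) at_top"
      using f2 f3 by (intro tendsto_intros to0) auto
    hence "\<forall>\<^sub>F \<tau> in at_top. A' * (freq 3 / freq 2) powr (- \<tau>) < d / 2"
      using d by (intro order_tendstoD) auto
    then obtain b0 where b0: "\<And>\<tau>. \<tau> \<ge> b0 \<Longrightarrow> A' * (freq 3 / freq 2) powr (- \<tau>) < d / 2"
      unfolding eventually_at_top_linorder by auto
    show ?thesis
    proof (intro exI conjI allI impI)
      show "d / 2 > 0" using d by simp
      show "freq 2 \<ge> 1" using f2 by simp
      fix N s assume N: "(N::nat) \<ge> 2" and t: "\<bar>Im s\<bar> \<ge> T * real N powr \<gamma>"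
        and \<sigma>: "Re s \<ge> \<delta> / 2 + max b0 (max \<tau>\<^sub>0 (\<sigma>\<^sub>1 - \<delta> / 2))"
      let ?F = "F_trunc p freq N s + G s * F_trunc q freq N (of_real \<delta> - s)"
      let ?x = "p 2 / of_real (freq 2) powr s"
      let ?\<tau> = "Re s - \<delta> / 2"
      have x: "norm ?x = d * freq 2 powr (- ?\<tau>)"
        using f2 norm_dterm[of freq 2 p s] by (simp add: dterm_def d_def mult.assoc flip: powr_add)
      have "norm (?F - (p 1 + ?x)) \<le> A' * freq 3 powr (- ?\<tau>)"
        using \<sigma> by (intro rest[OF N t]) auto
      also have "freq 3 powr (- ?\<tau>) = (freq 3 / freq 2) powr (- ?\<tau>) * freq 2 powr (- ?\<tau>)"
        using f2 f3 by (simp flip: powr_mult)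
      also have "A' * \<dots> = (A' * (freq 3 / freq 2) powr (- ?\<tau>)) * freq 2 powr (- ?\<tau>)" by simp
      also have "\<dots> \<le> (d / 2) * freq 2 powr (- ?\<tau>)"
        using b0[of ?\<tau>] \<sigma> by (intro mult_right_mono less_imp_le[OF b0]) auto
      finally have "norm (?F - ?x) \<le> (d / 2) * freq 2 powr (- ?\<tau>)" using True by simp
      moreover have "norm ?x \<le> norm ?F + norm (?F - ?x)"
        using norm_triangle_ineq4[of ?F "?F - ?x"] by simp
      ultimately show "norm ?F \<ge> d / 2 * freq 2 powr (- ?\<tau>)" unfolding x by (simp add: field_simps)
    qed
  qed
  then obtain c r b0 where crb: "c > 0" "r \<ge> 1"
    "\<And>N s. N \<ge> 2 \<Longrightarrow> \<bar>Im s\<bar> \<ge> T * real N powr \<gamma> \<Longrightarrow> Re s \<ge> \<delta> / 2 + b0 \<Longrightarrow>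
      norm (F_trunc p freq N s + G s * F_trunc q freq N (of_real \<delta> - s)) \<ge> c * r powr (- (Re s - \<delta> / 2))"
    by blast
  show ?thesis
  proof (rule that[of T \<gamma> "max 1 b0" M E c r])
    show "E \<ge> 0" using E1 KB G1 by (simp add: E_def)
  qed (use T \<gamma> M1 crb upper in auto)
qed

text \<open>Quantifying over all finite sets \<open>Z\<close> and admissible weights
  \<open>m\<close> avoids presupposing that the zeros in the strip are finite in number; that is
  derived later, with the help of the zero-free region in the first clause.\<close>

definition right_zeros_bounded :: "(complex \<Rightarrow> complex) \<Rightarrow> real \<Rightarrow> real \<Rightarrow> real \<Rightarrow> real \<Rightarrow> real \<Rightarrow> bool" where
  "right_zeros_bounded f x b V U B \<longleftrightarrow>
     (\<forall>s. V \<le> Im s \<and> Im s \<le> V + U \<and> Re s \<ge> x + b \<longrightarrow> f s \<noteq> 0) \<and>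
     (\<forall>Z m. finite Z \<and>
        (\<forall>\<rho>\<in>Z. x < Re \<rho> \<and> V < Im \<rho> \<and> Im \<rho> < V + U \<and> f \<rho> = 0 \<and> vanishes_to f \<rho> (m \<rho>)) \<longrightarrow>
        (\<Sum>\<rho>\<in>Z. real (m \<rho>) * (Re \<rho> - x)) \<le> B)"

text \<open>Feeds the bounds of \<open>dirichlet_pair_bounds\<close> into
  \<open>strip_zeros\<close>; the logarithm of their ratio is linear in \<open>ln N\<close>. Strips
  in the lower half plane are included because the point reflection sends the original strip
  there.\<close>

lemma dirichlet_pair_zeros:
  fixes p q :: "nat \<Rightarrow> complex" and freq :: "nat \<Rightarrow> real" and G :: "complex \<Rightarrow> complex"
    and \<Phi> :: "nat \<Rightarrow> complex \<Rightarrow> complex"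
  assumes G1: "C \<ge> 1" "L \<ge> 1" "e > 0" "y \<ge> 1" "\<tau>\<^sub>0 > 0"
    and G2: "\<And>s. \<bar>Im s\<bar> \<ge> y \<Longrightarrow> Re s \<ge> \<delta> / 2 \<Longrightarrow> norm (G s) \<le> C * L powr (Re s - \<delta> / 2)"
    and G3: "\<And>s. \<bar>Im s\<bar> \<ge> y \<Longrightarrow> Re s \<ge> \<delta> / 2 + \<tau>\<^sub>0 \<Longrightarrow>
       norm (G s) \<le> C * (L * \<bar>Im s\<bar> powr (- e)) powr (Re s - \<delta> / 2)"
    and freq: "strict_mono_on {1..} freq" "freq 1 = 1"
    and KB: "K \<ge> 1" "B \<ge> 0" "\<And>n. n \<ge> 1 \<Longrightarrow> freq n \<le> K * real n powr B"
      "\<And>n. n \<ge> 1 \<Longrightarrow> norm (p n) \<le> K * real n powr B" "\<And>n. n \<ge> 1 \<Longrightarrow> norm (q n) \<le> K * real n powr B"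
    and A: "\<And>N. (\<Sum>n=3..N. norm (p n) * freq n powr (- \<sigma>\<^sub>1)) \<le> A"
    and p2: "p 2 \<noteq> 0"
    and \<Phi>: "\<And>N s. \<Phi> N s = F_trunc p freq N s + G s * F_trunc q freq N (of_real \<delta> - s)"
    and hol: "\<And>N. \<Phi> N holomorphic_on {s. Im s \<noteq> 0}"
  obtains T \<gamma> b D :: real where "T > 0" "\<gamma> > 0" "D \<ge> 0"
    "\<And>N U V. N \<ge> 2 \<Longrightarrow> U > 0 \<Longrightarrow> V \<ge> T * real N powr \<gamma> \<or> V + U \<le> - (T * real N powr \<gamma>) \<Longrightarrow>
       right_zeros_bounded (\<Phi> N) (\<delta> / 2) b V U (D * ((U + 1) * ln (real N)))"
proof -
  obtain T\<^sub>0 \<gamma> b M E c r :: real where *: "T\<^sub>0 > 0" "\<gamma> > 0" "b \<ge> 1" "M \<ge> 1" "E \<ge> 0" "c > 0" "r \<ge> 1"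
    and up: "\<And>N s. N \<ge> 2 \<Longrightarrow> \<bar>Im s\<bar> \<ge> T\<^sub>0 * real N powr \<gamma> \<Longrightarrow> Re s \<ge> \<delta> / 2 \<Longrightarrow> norm (\<Phi> N s) \<le> M * real N powr E"
    and low: "\<And>N s. N \<ge> 2 \<Longrightarrow> \<bar>Im s\<bar> \<ge> T\<^sub>0 * real N powr \<gamma> \<Longrightarrow> Re s \<ge> \<delta> / 2 + b \<Longrightarrow>
       norm (\<Phi> N s) \<ge> c * r powr (- (Re s - \<delta> / 2))"
    using dirichlet_pair_bounds[OF G1 G2 G3 freq KB A p2] unfolding \<Phi> by blast
  \<comment> \<open>Since \<open>N powr \<gamma> \<ge> 1\<close>, the extra \<open>22 * b\<close>
    keeps the enlarged strip at heights
    \<open>\<bar>Im s\<bar> \<ge> T\<^sub>0 * N powr \<gamma>\<close>.\<close>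
  define T where "T = T\<^sub>0 + 22 * b"
  define m0 where "m0 = c * r powr (- b)"
  have m0: "m0 > 0" using * by (simp add: m0_def)
  \<comment> \<open>Since \<open>ln N \<ge> ln 2\<close>, the quotient by \<open>ln 2\<close> lets
    \<open>ln N\<close> absorb the constant \<open>ln (M / m0)\<close>.\<close>
  define D where "D = 9 * b * (\<bar>ln (M / m0)\<bar> / ln 2 + E)"
  have far: "\<bar>Im s\<bar> \<ge> T\<^sub>0 * real N powr \<gamma>"
    if "N \<ge> 2" "V \<ge> T * real N powr \<gamma> \<or> V + U \<le> - (T * real N powr \<gamma>)"
      "V - 22 * b \<le> Im s" "Im s \<le> V + U + 22 * b" for N U V s
  proof -
    have "real N powr \<gamma> \<ge> 1" using that(1) * by (simp add: ge_one_powr_ge_zero)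
    hence "22 * b * real N powr \<gamma> \<ge> 22 * b * 1" using * by (intro mult_left_mono) auto
    hence "T * real N powr \<gamma> \<ge> T\<^sub>0 * real N powr \<gamma> + 22 * b" by (simp add: T_def distrib_right)
    thus ?thesis using that(2-4) by linarith
  qed
  have nz: "\<Phi> N s \<noteq> 0"
    if "N \<ge> 2" "V \<ge> T * real N powr \<gamma> \<or> V + U \<le> - (T * real N powr \<gamma>)"
      "V \<le> Im s" "Im s \<le> V + U" "Re s \<ge> \<delta> / 2 + b" for N U V s
  proof -
    have "\<bar>Im s\<bar> \<ge> T\<^sub>0 * real N powr \<gamma>" using * that by (intro far[of N V U s]) auto
    from low[OF that(1) this that(5)] have "norm (\<Phi> N s) > 0" using * by (smt (verit) mult_pos_pos powr_gt_zero)
    thus ?thesis by simp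
  qed
  have sum: "(\<Sum>\<rho>\<in>Z. m \<rho> * (Re \<rho> - \<delta> / 2)) \<le> D * ((U + 1) * ln (real N))"
    if N: "N \<ge> 2" and U: "U > 0" and V: "V \<ge> T * real N powr \<gamma> \<or> V + U \<le> - (T * real N powr \<gamma>)"
      and Z: "finite Z" "\<And>\<rho>. \<rho> \<in> Z \<Longrightarrow> \<delta> / 2 < Re \<rho> \<and> V < Im \<rho> \<and> Im \<rho> < V + U \<and> \<Phi> N \<rho> = 0 \<and> vanishes_to (\<Phi> N) \<rho> (m \<rho>)"
    for N U V Z and m :: "complex \<Rightarrow> nat"
  proof -
    have "(\<Sum>\<rho>\<in>Z. m \<rho> * (Re \<rho> - \<delta> / 2)) \<le> (U + 1) * (9 * b * ln (M * real N powr E / m0))"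
    proof (rule strip_zeros[where S = "{s. Im s \<noteq> 0}" and f = "\<Phi> N" and V = V])
      show "b \<ge> 1" "U > 0" "finite Z" "m0 > 0" by fact+
      have "{s. Im s \<noteq> 0} = {s. Im s < 0} \<union> {s. Im s > 0}" by auto
      thus "open {s. Im s \<noteq> 0}"
        using open_halfspace_Im_lt[of 0] open_halfspace_Im_gt[of 0] by (simp only: open_Un)
      show "\<Phi> N holomorphic_on {s. Im s \<noteq> 0}" by (rule hol)
    next
      fix s assume s: "Re s \<ge> \<delta> / 2" "V - 22 * b \<le> Im s" "Im s \<le> V + U + 22 * b"
      have t: "\<bar>Im s\<bar> \<ge> T\<^sub>0 * real N powr \<gamma>" using far[OF N V s(2,3)] .
      moreover have "T\<^sub>0 * real N powr \<gamma> > 0" using * N by simp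
      ultimately show "s \<in> {s. Im s \<noteq> 0} \<and> norm (\<Phi> N s) \<le> M * real N powr E"
        using up[OF N t s(1)] by auto
    next
      fix s assume s: "Re s = \<delta> / 2 + b" "V \<le> Im s" "Im s \<le> V + U"
      have "\<bar>Im s\<bar> \<ge> T\<^sub>0 * real N powr \<gamma>" using far[OF N V, of s] s * by auto
      from low[OF N this] show "m0 \<le> norm (\<Phi> N s)" using s by (simp add: m0_def)
    next
      fix \<rho> assume "\<rho> \<in> Z"
      with Z(2)[OF this] nz[OF N V, of \<rho>]
      show "\<delta> / 2 < Re \<rho> \<and> Re \<rho> \<le> \<delta> / 2 + b \<and> V < Im \<rho> \<and> Im \<rho> < V + U \<and> vanishes_to (\<Phi> N) \<rho> (m \<rho>)"
        by force
    qed
    also have "\<dots> \<le> (U + 1) * (9 * b * ((\<bar>ln (M / m0)\<bar> / ln 2 + E) * ln (real N)))"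
    proof (intro mult_left_mono)
      have l2: "ln 2 \<le> ln (real N)" using N by simp
      have "ln (M * real N powr E / m0) = ln (M / m0 * real N powr E)" by simp
      also have "\<dots> = ln (M / m0) + E * ln (real N)"
        using * m0 N by (subst ln_mult) (auto simp: ln_powr)
      also have "ln (M / m0) \<le> \<bar>ln (M / m0)\<bar> / ln 2 * ln 2" by simp
      also have "\<dots> \<le> \<bar>ln (M / m0)\<bar> / ln 2 * ln (real N)"
        using l2 by (intro mult_left_mono) auto
      finally show "ln (M * real N powr E / m0) \<le> (\<bar>ln (M / m0)\<bar> / ln 2 + E) * ln (real N)"
        by (simp add: distrib_right)
    qed (use U * in auto)
    also have "\<dots> = D * ((U + 1) * ln (real N))" by (simp add: D_def)
    finally show ?thesis .
  qed
  show ?thesis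
  proof (rule that[of T \<gamma> D b])
    show "T > 0" "\<gamma> > 0" using * by (auto simp: T_def)
    show "D \<ge> 0" using * by (simp add: D_def)
    fix N U V assume h: "(N::nat) \<ge> 2" "(U::real) > 0" "V \<ge> T * real N powr \<gamma> \<or> V + U \<le> - (T * real N powr \<gamma>)"
    show "right_zeros_bounded (\<Phi> N) (\<delta> / 2) b V U (D * ((U + 1) * ln (real N)))"
      unfolding right_zeros_bounded_def using nz[OF h(1,3)] sum[OF h] by auto
  qed
qed

section \<open>Analytic properties of \<open>G\<close> and of the truncated series off the real
  axis\<close>

lemma Omega_holomorphic: "Omega k \<alpha> \<beta> holomorphic_on {s. \<forall>i\<in>{1..k}. Im (of_real (\<alpha> i) * s) \<noteq> 0}"
  unfolding Omega_def
  by (intro holomorphic_intros) (auto elim!: nonpos_Ints_cases simp: complex_eq_iff)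

text \<open>\<open>Gamma\<close> takes the value 0 only as the default at its poles, and for nonreal
  \<open>s\<close> no argument is a pole.\<close>

lemma Omega_nonzero:
  assumes "\<And>i. i \<in> {1..k} \<Longrightarrow> \<alpha> i > 0" "Im s \<noteq> 0"
  shows "Omega k \<alpha> \<beta> s \<noteq> 0"
proof -
  have "Gamma (of_real (\<alpha> i) * s + of_real (\<beta> i)) \<noteq> 0" if "i \<in> {1..k}" for i
    using assms(1)[OF that] assms(2) by (simp add: Gamma_eq_zero_iff not_nonpos_Ints_of_Im)
  thus ?thesis unfolding Omega_def by simp
qed

lemma G_factor_holomorphic:
  assumes "\<And>i. i \<in> {1..k} \<Longrightarrow> \<alpha> i > 0" "lam > 0"
  shows "G_factor k \<alpha> \<beta> lam \<delta> holomorphic_on {s. Im s \<noteq> 0}"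
proof -
  have 1: "Omega k \<alpha> \<beta> holomorphic_on {s. Im s \<noteq> 0}"
    using Omega_holomorphic by (rule holomorphic_on_subset) (use assms(1) in force)
  have "(Omega k \<alpha> \<beta> \<circ> (\<lambda>s. of_real \<delta> - s)) holomorphic_on {s. Im s \<noteq> 0}"
    by (rule holomorphic_on_compose_gen[OF _ 1]) (auto intro!: holomorphic_intros)
  thus ?thesis
    unfolding G_factor_def using assms 1 Omega_nonzero[OF assms(1)]
    by (intro holomorphic_intros) (auto simp: o_def)
qed

text \<open>The exponents of \<open>lam\<close> at \<open>s\<close> and \<open>\<delta> - s\<close>
  add up to 0, and the quotients of \<open>Omega\<close> are reciprocal.\<close>

lemma G_factor_reflect:
  assumes "\<And>i. i \<in> {1..k} \<Longrightarrow> \<alpha> i > 0" "lam > 0" "Im s \<noteq> 0"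
  shows "G_factor k \<alpha> \<beta> lam \<delta> s * G_factor k \<alpha> \<beta> lam \<delta> (of_real \<delta> - s) = 1"
proof -
  have "of_real lam powr (2 * s - of_real \<delta>) * of_real lam powr (2 * (of_real \<delta> - s) - of_real \<delta>)
      = (of_real lam :: complex) powr ((2 * s - of_real \<delta>) + (2 * (of_real \<delta> - s) - of_real \<delta>))"
    by (rule powr_add[symmetric])
  also have "\<dots> = 1" using assms(2) by simp
  finally show ?thesis
    using Omega_nonzero[OF assms(1), where s = s] Omega_nonzero[OF assms(1), where s = "of_real \<delta> - s"] assms(3)
    unfolding G_factor_def by simp
qed

lemma F_trunc_holomorphic:
  assumes "\<And>n. n \<ge> 1 \<Longrightarrow> freq n > 0"
  shows "F_trunc p freq N holomorphic_on S"
proof -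
  have "of_real (freq n) \<noteq> (0 :: complex)" if "n \<in> {1..N}" for n
    using assms[of n] that by auto
  thus ?thesis unfolding F_trunc_def dterm_def by (intro holomorphic_intros) auto
qed

lemma polynomially_bounded_common:
  fixes x :: "nat \<Rightarrow> 'a :: real_normed_vector" and z :: "nat \<Rightarrow> 'b :: real_normed_vector"
  assumes "polynomially_bounded x" "polynomially_bounded z"
  obtains K B :: real where "K \<ge> 1" "B \<ge> 0"
    "\<And>n. n \<ge> 1 \<Longrightarrow> norm (x n) \<le> K * real n powr B" "\<And>n. n \<ge> 1 \<Longrightarrow> norm (z n) \<le> K * real n powr B"
proof -
  obtain K1 B1 where 1: "\<And>n. n \<ge> 1 \<Longrightarrow> norm (x n) \<le> K1 * real n powr B1"
    using assms(1) unfolding polynomially_bounded_def by blast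
  obtain K2 B2 where 2: "\<And>n. n \<ge> 1 \<Longrightarrow> norm (z n) \<le> K2 * real n powr B2"
    using assms(2) unfolding polynomially_bounded_def by blast
  have "K1 * real n powr B1 \<le> (1 + \<bar>K1\<bar> + \<bar>K2\<bar>) * real n powr (\<bar>B1\<bar> + \<bar>B2\<bar>)" if "n \<ge> 1" for n
    using that by (intro mult_mono powr_mono) auto
  moreover have "K2 * real n powr B2 \<le> (1 + \<bar>K1\<bar> + \<bar>K2\<bar>) * real n powr (\<bar>B1\<bar> + \<bar>B2\<bar>)" if "n \<ge> 1" for n
    using that by (intro mult_mono powr_mono) auto
  ultimately show ?thesis using order_trans[OF 1] order_trans[OF 2]
    by (intro that[of "1 + \<bar>K1\<bar> + \<bar>K2\<bar>" "\<bar>B1\<bar> + \<bar>B2\<bar>"]) auto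
qed

section \<open>The count of distant a-values\<close>

theorem theorem1p5:
  fixes coef :: "nat \<Rightarrow> complex" and freq :: "nat \<Rightarrow> real"
    and F :: "complex \<Rightarrow> complex"
    and k :: nat and \<alpha> \<beta> :: "nat \<Rightarrow> real" and lam \<delta> :: real
    and a :: complex
  assumes "strict_mono_on {1..} freq" and "freq 1 = 1"
    and "coef 2 \<noteq> 0" and "coef 3 \<noteq> 0"
    and "polynomially_bounded coef" and "polynomially_bounded freq"
    and "continues_dirichlet_series coef freq F"
    and "k \<ge> 1" and "\<And>i. i \<in> {1..k} \<Longrightarrow> \<alpha> i > 0" and "lam > 0"
    and "functional_equation k \<alpha> \<beta> lam \<delta> F"
  shows "\<exists>T\<^sub>a>0. \<exists>\<gamma>>0. \<exists>C\<^sub>1 C\<^sub>2 :: real.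
    \<forall>N::nat. N \<ge> 2 \<longrightarrow> (\<forall>U>0. \<forall>T. T \<ge> T\<^sub>a * real N powr \<gamma> \<longrightarrow> (\<forall>\<epsilon>>0.
      (let Z = zeta_trunc coef freq k \<alpha> \<beta> lam \<delta> N in
        (\<forall>s \<in> a_values Z a. Im s \<noteq> T \<and> Im s \<noteq> T + U \<and>
            (T \<le> Im s \<and> Im s \<le> T + U \<longrightarrow> \<bar>Re s - \<delta> / 2\<bar> \<noteq> \<epsilon>))
        \<longrightarrow>
        finite (a_values Z a \<inter> strip T U) \<and>
        \<bar>real_of_int (count_a_values Z a (strip T U)
            - count_a_values Z a (strip T U \<inter> near_line \<delta> \<epsilon>))\<bar>
          \<le> C\<^sub>1 * (U * ln (real N) / \<epsilon>) + C\<^sub>2 * (real N powr (2 * \<gamma>) * ln (T + U) / \<epsilon>))))"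
proof -
  note freq = assms(1,2) and \<alpha> = assms(9)
  define G where "G = G_factor k \<alpha> \<beta> lam \<delta>"
  \<comment> \<open>Since \<open>freq 1 = 1\<close>, subtracting \<open>a\<close> amounts to
    changing the first coefficient.\<close>
  define coef' where "coef' = coef(1 := coef 1 - a)"
  have G_hol: "G holomorphic_on {s. Im s \<noteq> 0}"
    unfolding G_def using assms(9,10) by (rule G_factor_holomorphic)
  have G_refl: "G s * G (of_real \<delta> - s) = 1" if "Im s \<noteq> 0" for s
    unfolding G_def using \<alpha> assms(10) that by (rule G_factor_reflect)
  have fpos: "freq n > 0" if "n \<ge> 1" for n
    using strict_mono_onD[OF freq(1), of 1 n] freq(2) that by (cases "n = 1") auto
  obtain C L e y \<tau>\<^sub>0 where G1: "C \<ge> 1" "L \<ge> 1" "e > 0" "y \<ge> 1" "\<tau>\<^sub>0 > 0"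
    and G2: "\<And>s. \<bar>Im s\<bar> \<ge> y \<Longrightarrow> Re s \<ge> \<delta> / 2 \<Longrightarrow> norm (G s) \<le> C * L powr (Re s - \<delta> / 2)"
    and G3: "\<And>s. \<bar>Im s\<bar> \<ge> y \<Longrightarrow> Re s \<ge> \<delta> / 2 + \<tau>\<^sub>0 \<Longrightarrow>
       norm (G s) \<le> C * (L * \<bar>Im s\<bar> powr (- e)) powr (Re s - \<delta> / 2)"
    unfolding G_def using G_factor_bound[where \<alpha> = \<alpha> and \<beta> = \<beta> and \<delta> = \<delta>, OF assms(8,9,10)] by blast
  obtain K\<^sub>0 B where KB: "K\<^sub>0 \<ge> 1" "B \<ge> 0" "\<And>n. n \<ge> 1 \<Longrightarrow> norm (coef n) \<le> K\<^sub>0 * real n powr B"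
      "\<And>n. n \<ge> 1 \<Longrightarrow> norm (freq n) \<le> K\<^sub>0 * real n powr B"
    using polynomially_bounded_common[OF assms(5,6)] by blast
  define K where "K = K\<^sub>0 + norm a"
  have K: "K \<ge> 1" "K\<^sub>0 \<le> K" using KB(1) norm_ge_zero[of a] unfolding K_def by linarith+
  have K0K: "K\<^sub>0 * real n powr B \<le> K * real n powr B" for n using K by (intro mult_right_mono) auto
  have freqK: "freq n \<le> K * real n powr B" if "n \<ge> 1" for n
    using KB(4)[OF that] K0K[of n] by simp
  have coefK: "norm (coef n) \<le> K * real n powr B" if "n \<ge> 1" for n
    using KB(3)[OF that] K0K[of n] by simp
  have coefK': "norm (coef' n) \<le> K * real n powr B" if "n \<ge> 1" for n
  proof (cases "n = 1")
    case True
    thus ?thesis using KB(3)[of 1] norm_triangle_ineq4[of "coef 1" a] by (simp add: coef'_def K_def)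
  qed (use coefK[OF that] in \<open>simp add: coef'_def\<close>)
  obtain \<sigma>\<^sub>0 where \<sigma>\<^sub>0: "\<And>s. Re s > \<sigma>\<^sub>0 \<Longrightarrow> (\<lambda>n. norm (dterm coef freq s n)) summable_on {1..}"
    using assms(7) unfolding continues_dirichlet_series_def by blast
  define \<sigma>\<^sub>1 where "\<sigma>\<^sub>1 = \<sigma>\<^sub>0 + 1"
  \<comment> \<open>The full sum at the point \<open>\<sigma>\<^sub>1\<close> of absolute
    convergence bounds all tails uniformly in \<open>N\<close>; \<open>coef'\<close> has the same
    tails from \<open>n = 3\<close>.\<close>
  define A where "A = infsum (\<lambda>n. norm (dterm coef freq (of_real \<sigma>\<^sub>1) n)) {1..}"
  have A: "(\<Sum>n=3..N. norm (coef n) * freq n powr (- \<sigma>\<^sub>1)) \<le> A" for N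
  proof -
    have "(\<Sum>n=3..N. norm (coef n) * freq n powr (- \<sigma>\<^sub>1)) = (\<Sum>n=3..N. norm (dterm coef freq (of_real \<sigma>\<^sub>1) n))"
      by (intro sum.cong refl) (simp add: norm_dterm fpos)
    also have "\<dots> \<le> A" unfolding A_def
      by (intro finite_sum_le_infsum \<sigma>\<^sub>0) (auto simp: \<sigma>\<^sub>1_def)
    finally show ?thesis .
  qed
  have A': "(\<Sum>n=3..N. norm (coef' n) * freq n powr (- \<sigma>\<^sub>1)) \<le> A" for N
  proof -
    have "(\<Sum>n=3..N. norm (coef' n) * freq n powr (- \<sigma>\<^sub>1)) = (\<Sum>n=3..N. norm (coef n) * freq n powr (- \<sigma>\<^sub>1))"
      by (intro sum.cong refl) (auto simp: coef'_def)
    thus ?thesis using A[of N] by simp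
  qed
  have hol: "(\<lambda>s. F_trunc p freq N s + G s * F_trunc q freq N (of_real \<delta> - s)) holomorphic_on {s. Im s \<noteq> 0}" for p q N
  proof -
    have "(F_trunc q freq N \<circ> (\<lambda>s. of_real \<delta> - s)) holomorphic_on {s. Im s \<noteq> 0}"
      by (rule holomorphic_on_compose_gen[OF _ F_trunc_holomorphic[of freq q N UNIV]])
        (auto intro!: holomorphic_intros fpos)
    thus ?thesis using F_trunc_holomorphic[of freq p N] fpos
      by (intro holomorphic_intros G_hol) (auto simp: o_def)
  qed
  \<comment> \<open>\<open>f\<close> is \<open>zeta_trunc - a\<close>, and \<open>g\<close> is its
    partner under the point reflection: \<open>f s = G s * g (\<delta> - s)\<close>. They differ by
    exchanging \<open>coef\<close> and \<open>coef'\<close>, so the same lemma handles both.\<close>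
  define f where "f N s = F_trunc coef' freq N s + G s * F_trunc coef freq N (of_real \<delta> - s)" for N s
  define g where "g N s = F_trunc coef freq N s + G s * F_trunc coef' freq N (of_real \<delta> - s)" for N s
  have f_hol: "f N holomorphic_on {s. Im s \<noteq> 0}" for N unfolding f_def by (rule hol)
  have g_hol: "g N holomorphic_on {s. Im s \<noteq> 0}" for N unfolding g_def by (rule hol)
  have nz2: "coef 2 \<noteq> 0" "coef' 2 \<noteq> 0" using assms(3) by (auto simp: coef'_def)
  obtain T1 \<gamma>1 b1 D1 where 1: "T1 > 0" "\<gamma>1 > 0" "D1 \<ge> 0"
    and zf: "\<And>N U V. N \<ge> 2 \<Longrightarrow> U > 0 \<Longrightarrow> V \<ge> T1 * real N powr \<gamma>1 \<or> V + U \<le> - (T1 * real N powr \<gamma>1) \<Longrightarrow>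
       right_zeros_bounded (f N) (\<delta> / 2) b1 V U (D1 * ((U + 1) * ln (real N)))"
  proof (rule dirichlet_pair_zeros[where \<Phi> = f and p = coef' and q = coef and G = G, OF G1])
    show "norm (G s) \<le> C * L powr (Re s - \<delta> / 2)" if "\<bar>Im s\<bar> \<ge> y" "Re s \<ge> \<delta> / 2" for s
      using that by (rule G2)
    show "norm (G s) \<le> C * (L * \<bar>Im s\<bar> powr (- e)) powr (Re s - \<delta> / 2)"
      if "\<bar>Im s\<bar> \<ge> y" "Re s \<ge> \<delta> / 2 + \<tau>\<^sub>0" for s
      using that by (rule G3)
  qed (rule freq K(1) KB(2) freqK coefK coefK' A A' nz2 f_def f_hol that; assumption)+
  obtain T2 \<gamma>2 b2 D2 where 2: "T2 > 0" "\<gamma>2 > 0" "D2 \<ge> 0"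
    and zg: "\<And>N U V. N \<ge> 2 \<Longrightarrow> U > 0 \<Longrightarrow> V \<ge> T2 * real N powr \<gamma>2 \<or> V + U \<le> - (T2 * real N powr \<gamma>2) \<Longrightarrow>
       right_zeros_bounded (g N) (\<delta> / 2) b2 V U (D2 * ((U + 1) * ln (real N)))"
  proof (rule dirichlet_pair_zeros[where \<Phi> = g and p = coef and q = coef' and G = G, OF G1])
    show "norm (G s) \<le> C * L powr (Re s - \<delta> / 2)" if "\<bar>Im s\<bar> \<ge> y" "Re s \<ge> \<delta> / 2" for s
      using that by (rule G2)
    show "norm (G s) \<le> C * (L * \<bar>Im s\<bar> powr (- e)) powr (Re s - \<delta> / 2)"
      if "\<bar>Im s\<bar> \<ge> y" "Re s \<ge> \<delta> / 2 + \<tau>\<^sub>0" for s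
      using that by (rule G3)
  qed (rule freq K(1) KB(2) freqK coefK coefK' A A' nz2 g_def g_hol that; assumption)+
  define \<gamma> where "\<gamma> = \<gamma>1 + \<gamma>2"
  \<comment> \<open>The summand 3 gives \<open>T \<ge> 3\<close>, hence
    \<open>ln (T + U) \<ge> 1\<close>.\<close>
  define Ta where "Ta = T1 + T2 + 3"
  define D where "D = D1 + D2"
  have D: "D \<ge> 0" using 1 2 by (simp add: D_def)
  have \<gamma>: "\<gamma> > 0" using 1 2 by (simp add: \<gamma>_def)
  have f_eq: "zeta_trunc coef freq k \<alpha> \<beta> lam \<delta> N s - a = f N s" if "N \<ge> 2" for N s
  proof -
    have "F_trunc coef' freq N s = F_trunc coef freq N s - a"
      using that freq(2) unfolding F_trunc_def
      by (simp add: sum.atLeast_Suc_atMost dterm_def coef'_def)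
    thus ?thesis unfolding zeta_trunc_def f_def G_def by simp
  qed
  have fg: "f N s = G s * g N (of_real \<delta> - s)" if "Im s \<noteq> 0" for N s
  proof -
    have "G s * g N (of_real \<delta> - s) = G s * F_trunc coef freq N (of_real \<delta> - s)
        + (G s * G (of_real \<delta> - s)) * F_trunc coef' freq N s"
      unfolding g_def by (simp add: distrib_left mult.assoc)
    thus ?thesis using G_refl[OF that] by (simp add: f_def add.commute)
  qed
  have main: "finite (a_values Z a \<inter> strip T U) \<and>
        \<bar>real_of_int (count_a_values Z a (strip T U) - count_a_values Z a (strip T U \<inter> near_line \<delta> \<epsilon>))\<bar>
          \<le> D * (U * ln (real N) / \<epsilon>) + D / \<gamma> * (real N powr (2 * \<gamma>) * ln (T + U) / \<epsilon>)"
    if N: "N \<ge> 2" and U: "U > 0" and T: "T \<ge> Ta * real N powr \<gamma>" and \<epsilon>: "\<epsilon> > 0"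
      and Z: "Z = zeta_trunc coef freq k \<alpha> \<beta> lam \<delta> N" for N U T \<epsilon> Z
  proof -
    have Nx: "real N powr x \<le> real N powr \<gamma>" "1 \<le> real N powr x" if "0 \<le> x" "x \<le> \<gamma>" for x
      using N that by (auto intro!: powr_mono simp: ge_one_powr_ge_zero)
    have "T1 * real N powr \<gamma>1 \<le> Ta * real N powr \<gamma>"
      using 1 2 by (intro mult_mono Nx) (auto simp: Ta_def \<gamma>_def)
    hence V1: "T \<ge> T1 * real N powr \<gamma>1 \<or> T + U \<le> - (T1 * real N powr \<gamma>1)" using T by linarith
    have "T2 * real N powr \<gamma>2 \<le> Ta * real N powr \<gamma>"
      using 1 2 by (intro mult_mono Nx) (auto simp: Ta_def \<gamma>_def)
    \<comment> \<open>The reflected strip starts at height \<open>-(T + U)\<close>, has the same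
      length \<open>U\<close> and lies in the lower half plane.\<close>
    hence V2: "- (T + U) \<ge> T2 * real N powr \<gamma>2 \<or> - (T + U) + U \<le> - (T2 * real N powr \<gamma>2)" using T by linarith
    have nzf: "f N s \<noteq> 0" if "T \<le> Im s" "Im s \<le> T + U" "Re s \<ge> \<delta> / 2 + b1" for s
      using zf[OF N U V1] that unfolding right_zeros_bounded_def by blast
    have nzg: "g N s \<noteq> 0" if "- (T + U) \<le> Im s" "Im s \<le> - T" "Re s \<ge> \<delta> / 2 + b2" for s
      using zg[OF N U V2] that unfolding right_zeros_bounded_def by auto
    have "3 * 1 \<le> Ta * real N powr \<gamma>"
      using 1 2 \<gamma> by (intro mult_mono Nx) (auto simp: Ta_def)
    hence T3: "T \<ge> 3" using T by linarith
    define S where "S = {s. Im s > 0}"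
    have S: "open S" "connected S"
      unfolding S_def by (auto simp: open_halfspace_Im_gt convex_halfspace_Im_gt intro!: convex_connected)
    have fS: "f N holomorphic_on S"
      by (rule holomorphic_on_subset[OF f_hol]) (auto simp: S_def)
    have GS: "G holomorphic_on S" using G_hol by (rule holomorphic_on_subset) (auto simp: S_def)
    have av: "a_values Z a = {s. f N s = 0}" unfolding a_values_def Z by (simp add: f_eq[OF N])
    have strip_S: "strip T U \<subseteq> S" using T3 by (auto simp: strip_def S_def)
    have G0: "G s \<noteq> 0" if "s \<in> S" for s using G_refl[of s] that by (auto simp: S_def)
    have g0: "g N (of_real \<delta> - s) = 0" if "s \<in> S" "f N s = 0" for s
      using fg[of s N] G0[OF that(1)] that by (auto simp: S_def)
    define Q where "Q = a_values Z a \<inter> strip T U"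
    have Q: "f N s = 0" "T < Im s" "Im s < T + U" "s \<in> S" if "s \<in> Q" for s
      using that strip_S unfolding Q_def av by (auto simp: strip_def)
    define w where "w = Complex (\<delta> / 2 + b1) T"
    have w: "w \<in> S" "f N w \<noteq> 0"
      using T3 U nzf[of w] by (auto simp: S_def w_def)
    \<comment> \<open>The zero-free region of \<open>f\<close> bounds the real parts from above,
      that of \<open>g\<close> from below. The zeros in the strip thus lie in a compact box inside
      the upper half plane, which makes them finite in number.\<close>
    have Qbox: "Q \<subseteq> {s \<in> cbox (Complex (\<delta> / 2 - b2) T) (Complex (\<delta> / 2 + b1) (T + U)). f N s = 0}"
    proof safe
      fix s assume s: "s \<in> Q"
      show "f N s = 0" using Q[OF s] by simp
      have "Re s \<le> \<delta> / 2 + b1" using nzf[of s] Q[OF s] by force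
      moreover have "Re s \<ge> \<delta> / 2 - b2"
        using nzg[of "of_real \<delta> - s"] g0[of s] Q[OF s] by force
      ultimately show "s \<in> cbox (Complex (\<delta> / 2 - b2) T) (Complex (\<delta> / 2 + b1) (T + U))"
        using Q[OF s] by (simp add: in_cbox_complex_iff)
    qed
    have finQ: "finite Q"
    proof (cases "f N constant_on S")
      case True
      hence "f N s \<noteq> 0" if "s \<in> S" for s using w that by (auto simp: constant_on_def)
      hence "Q = {}" using Q by blast
      thus ?thesis by simp
    next
      case False
      show ?thesis
      proof (rule finite_subset[OF Qbox holomorphic_compact_finite_zeros[OF fS S _ _ False]])
        show "compact (cbox (Complex (\<delta> / 2 - b2) T) (Complex (\<delta> / 2 + b1) (T + U)))" by (rule compact_cbox)
        show "cbox (Complex (\<delta> / 2 - b2) T) (Complex (\<delta> / 2 + b1) (T + U)) \<subseteq> S"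
          using T3 by (auto simp: in_cbox_complex_iff S_def)
      qed
    qed
    define m where "m s = nat (zorder (f N) s)" for s
    have zo: "(\<lambda>z. Z z - a) = f N" unfolding Z by (auto simp: f_eq[OF N])
    have m: "vanishes_to (f N) s (m s)" "zorder (f N) s = int (m s)" if "s \<in> Q" for s
      using vanishes_to_zorder[OF fS S _ w, of s] Q[OF that] by (auto simp: m_def)
    define Qr where "Qr = {s\<in>Q. Re s - \<delta> / 2 \<ge> \<epsilon>}"
    define Ql where "Ql = {s\<in>Q. \<delta> / 2 - Re s \<ge> \<epsilon>}"
    have fin: "finite Qr" "finite Ql" using finQ by (auto simp: Qr_def Ql_def)
    have "count_a_values Z a (strip T U) - count_a_values Z a (strip T U \<inter> near_line \<delta> \<epsilon>)
        = (\<Sum>s\<in>Q. zorder (f N) s) - (\<Sum>s\<in>Q \<inter> near_line \<delta> \<epsilon>. zorder (f N) s)"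
      unfolding count_a_values_def zo Q_def by (simp add: Int_assoc)
    also have "\<dots> = (\<Sum>s\<in>Q - Q \<inter> near_line \<delta> \<epsilon>. zorder (f N) s)"
      using finQ by (subst sum_diff) auto
    also have "Q - Q \<inter> near_line \<delta> \<epsilon> = Qr \<union> Ql"
      by (auto simp: Qr_def Ql_def near_line_def)
    also have "(\<Sum>s\<in>Qr \<union> Ql. zorder (f N) s) = (\<Sum>s\<in>Qr. zorder (f N) s) + (\<Sum>s\<in>Ql. zorder (f N) s)"
      using fin \<epsilon> by (intro sum.union_disjoint) (auto simp: Qr_def Ql_def)
    also have "\<dots> = int ((\<Sum>s\<in>Qr. m s) + (\<Sum>s\<in>Ql. m s))"
      using m(2) by (simp add: Qr_def Ql_def)
    finally have cnt: "count_a_values Z a (strip T U) - count_a_values Z a (strip T U \<inter> near_line \<delta> \<epsilon>)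
        = int ((\<Sum>s\<in>Qr. m s) + (\<Sum>s\<in>Ql. m s))" .
    have r: "real (\<Sum>s\<in>Qr. m s) * \<epsilon> \<le> D1 * ((U + 1) * ln (real N))"
    proof -
      have "real (\<Sum>s\<in>Qr. m s) * \<epsilon> = (\<Sum>s\<in>Qr. m s * \<epsilon>)" by (simp add: sum_distrib_right)
      \<comment> \<open>Each zero counted here is at distance at least \<open>\<epsilon>\<close>
        from the critical line, so the weighted sum of distances controls \<open>\<epsilon>\<close>
        times the count.\<close>
      also have "\<dots> \<le> (\<Sum>s\<in>Qr. m s * (Re s - \<delta> / 2))"
        by (intro sum_mono mult_left_mono) (auto simp: Qr_def)
      also have "\<dots> \<le> D1 * ((U + 1) * ln (real N))"
        using Q m(1) \<epsilon>
        by (intro zf[OF N U V1, unfolded right_zeros_bounded_def, THEN conjunct2, rule_format])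
          (auto simp: Qr_def fin(1)[unfolded Qr_def])
      finally show ?thesis .
    qed
    have l: "real (\<Sum>s\<in>Ql. m s) * \<epsilon> \<le> D2 * ((U + 1) * ln (real N))"
    proof -
      define R where "R s = of_real \<delta> - s" for s :: complex
      have RR: "R (R s) = s" for s by (simp add: R_def)
      hence inj: "inj_on R X" for X by (metis inj_onI)
      have "real (\<Sum>s\<in>Ql. m s) * \<epsilon> = (\<Sum>s\<in>Ql. m s * \<epsilon>)" by (simp add: sum_distrib_right)
      also have "\<dots> \<le> (\<Sum>s\<in>Ql. m s * (\<delta> / 2 - Re s))"
        by (intro sum_mono mult_left_mono) (auto simp: Ql_def)
      \<comment> \<open>Reindexing by the involution \<open>R\<close> turns distances on the left
        into distances on the right, where the bound for \<open>g\<close> applies.\<close>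
      also have "\<dots> = (\<Sum>\<rho>\<in>R ` Ql. m (R \<rho>) * (Re \<rho> - \<delta> / 2))"
        by (subst sum.reindex[OF inj]) (simp add: RR, simp add: R_def)
      also have "\<dots> \<le> D2 * ((U + 1) * ln (real N))"
      proof (rule zg[OF N U V2, unfolded right_zeros_bounded_def, THEN conjunct2, rule_format],
          intro conjI ballI)
        fix \<rho> assume "\<rho> \<in> R ` Ql"
        then obtain s where s: "s \<in> Ql" "\<rho> = R s" by auto
        hence sQ: "s \<in> Q" by (simp add: Ql_def)
        have "vanishes_to (g N) (of_real \<delta> - s) (m s)"
          by (rule vanishes_to_reflect[OF m(1)[OF sQ] S(1) Q(4)[OF sQ] GS G0[OF Q(4)[OF sQ]]])
            (auto simp: S_def intro!: fg)
        thus "vanishes_to (g N) \<rho> (m (R \<rho>))" using s by (simp add: RR) (simp add: R_def)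
        show "\<delta> / 2 < Re \<rho>" "- (T + U) < Im \<rho>" "Im \<rho> < - (T + U) + U" "g N \<rho> = 0"
          using s \<epsilon> Q[OF sQ] g0[of s] by (auto simp: R_def Ql_def)
      qed (use fin in auto)
      finally show ?thesis .
    qed
    have "real ((\<Sum>s\<in>Qr. m s) + (\<Sum>s\<in>Ql. m s)) \<le> D * ((U + 1) * ln (real N)) / \<epsilon>"
      using r l \<epsilon> by (simp add: D_def field_simps)
    also have "\<dots> = D * (U * ln (real N) / \<epsilon>) + D * ln (real N) / \<epsilon>"
      by (simp add: add_divide_distrib distrib_left distrib_right)
    \<comment> \<open>The summand 1 in \<open>U + 1\<close> leaves this term without
      \<open>U\<close>. It goes into the second error term by
      \<open>ln N \<le> N powr \<gamma> / \<gamma>\<close> and \<open>ln (T + U) \<ge> 1\<close>,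
      whence the constant \<open>D / \<gamma>\<close>.\<close>
    also have "D * ln (real N) / \<epsilon> \<le> D * (real N powr (2 * \<gamma>) * ln (T + U) / \<gamma>) / \<epsilon>"
    proof (intro divide_right_mono mult_left_mono)
      have "ln (real N) \<le> real N powr \<gamma> / \<gamma>" using N \<gamma> by (intro ln_powr_bound) auto
      also have "\<dots> \<le> real N powr (2 * \<gamma>) * ln (T + U) / \<gamma>"
      proof (intro divide_right_mono)
        have "1 \<le> ln (T + U)" using T3 U exp_le by (subst ln_ge_iff) auto
        moreover have "real N powr \<gamma> \<le> real N powr (2 * \<gamma>)" using N \<gamma> by (intro powr_mono) auto
        ultimately show "real N powr \<gamma> \<le> real N powr (2 * \<gamma>) * ln (T + U)"
          using mult_mono[of "real N powr \<gamma>" "real N powr (2 * \<gamma>)" 1 "ln (T + U)"] by simp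
      qed (use \<gamma> in simp)
      finally show "ln (real N) \<le> real N powr (2 * \<gamma>) * ln (T + U) / \<gamma>" .
    qed (use D \<epsilon> in auto)
    finally have "real ((\<Sum>s\<in>Qr. m s) + (\<Sum>s\<in>Ql. m s)) \<le>
        D * (U * ln (real N) / \<epsilon>) + D / \<gamma> * (real N powr (2 * \<gamma>) * ln (T + U) / \<epsilon>)"
      by (simp add: mult_ac)
    thus ?thesis using finQ unfolding cnt Q_def of_int_of_nat_eq abs_of_nat by blast
  qed
  have "Ta > 0" using 1 2 by (simp add: Ta_def)
  show ?thesis
    unfolding Let_def
    by (rule exI[of _ Ta], rule conjI[OF \<open>Ta > 0\<close>], rule exI[of _ \<gamma>], rule conjI[OF \<gamma>],
        rule exI[of _ D], rule exI[of _ "D / \<gamma>"], intro allI impI, rule main) auto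
qed

end
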